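(* For positive integers $m,n$ put $\Delta_{m,n}=-16(27n^4-4m^6)$. For $x>0$ define $$\mathcal{N}(x)=\#\{n\in(0,x]\cap\mathbb{Z} : \text{the } p\text{-primary part of } \Delta_{1,n} \text{ is square-free for every prime } p>3\},$$ $$\mathcal{M}(x)=\#\{m\in(0,x]\cap\mathbb{Z} : \text{the } p\text{-primary part of } \Delta_{m,1} \text{ is square-free for every prime } p>3\}.$$ Suppose that the $abc$ conjecture is true. Then there exist constants $\kappa_1,\kappa_2>0.97$ such that, as $x\to\infty$, $$\mathcal{N}(x)\sim\kappa_1 x,\qquad \mathcal{M}(x)\sim\kappa_2 x.$$
   Context: "The $p$-primary part of $\Delta$ is square-free" means $p^2\nmid\Delta$. The $abc$ conjecture: for every $\varepsilon>0$ there is a constant $C_\varepsilon>0$ such that for all coprime positive integers $a,b,c$ with $a+b=c$ one has $c\le C_\varepsilon\left(\prod_{p\mid abc}p\right)^{1+\varepsilon}$, the product being over primes. $A(x)\sim B(x)$ means $A(x)/B(x)\to1$ as $x\to\infty$. *)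

theory Defs
  imports
    Complex_Main
    "HOL-Computational_Algebra.Primes"
    "HOL-Library.Landau_Symbols"
begin

definition abc_conjecture :: bool where
  "abc_conjecture \<longleftrightarrow>
    (\<forall>\<epsilon>::real. \<epsilon> > 0 \<longrightarrow>
      (\<exists>C::real. C > 0 \<and>
        (\<forall>a b c :: nat. a > 0 \<and> b > 0 \<and> c > 0 \<and> Gcd {a, b, c} = 1 \<and> a + b = c \<longrightarrow>
          real c \<le> C * real (\<Prod>p | prime p \<and> p dvd a * b * c. p) powr (1 + \<epsilon>))))"

definition Delta :: "int \<Rightarrow> int \<Rightarrow> int" where
  "Delta m n = - 16 * (27 * n ^ 4 - 4 * m ^ 6)"

definition primary_part_squarefree :: "int \<Rightarrow> int \<Rightarrow> bool" where
  "primary_part_squarefree p d \<longleftrightarrow> \<not> p ^ 2 dvd d"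

definition count_N :: "real \<Rightarrow> nat" where
  "count_N x = card {n :: int. 0 < real_of_int n \<and> real_of_int n \<le> x \<and>
     (\<forall>p :: int. prime p \<and> p > 3 \<longrightarrow> primary_part_squarefree p (Delta 1 n))}"

definition count_M :: "real \<Rightarrow> nat" where
  "count_M x = card {m :: int. 0 < real_of_int m \<and> real_of_int m \<le> x \<and>
     (\<forall>p :: int. prime p \<and> p > 3 \<longrightarrow> primary_part_squarefree p (Delta m 1))}"

end

theory Submission
  imports
    Defs
    "HOL-Analysis.Harmonic_Numbers"
    "HOL-Computational_Algebra.Polynomial"
    "HOL-Number_Theory.Number_Theory"
    "HOL-Real_Asymp.Real_Asymp"
begin

text \<open>Let \<open>f n = \<alpha> n\<^sup>k - \<beta>\<close>, the cases of interest being \<open>27 n\<^sup>4 - 4\<close> and \<open>4 n\<^sup>6 - 27\<close>.  Sieving by the squares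
  of the primes up to \<open>X\<close> to the power \<open>2/3\<close> is elementary, so a density exists and is at least one minus the
  sum of \<open>\<rho>(p) / p\<^sup>2\<close>, where \<open>\<rho>(p)\<close> counts the roots of \<open>f\<close> modulo \<open>p\<^sup>2\<close>, provided that only \<open>o(X)\<close> integers \<open>n\<close> up to \<open>X\<close> have a prime \<open>q\<close> with
  \<open>q\<^sup>3 > X\<^sup>2\<close> and \<open>q\<^sup>2\<close> dividing \<open>f n\<close>.

  Granville deduces such a bound from the abc conjecture by comparing \<open>f\<close> at nearby integers, which needs Belyi
  maps for general polynomials.  Here \<open>f (a n)\<close> and \<open>f (b n)\<close> are compared instead, for distinct odd primes
  \<open>a\<close> and \<open>b\<close>.  As functions of \<open>n\<^sup>k\<close> they are linear, so only the four rational points \<open>0\<close>, infinity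
  and the two roots have to be mapped to three, which the single Belyi function \<open>x\<^sup>M (1 - x)\<^sup>N\<close> does.  The abc
  conjecture then shows that for large \<open>n\<close> not both values have a large square divisor, and almost every integer
  \<open>m\<close> can be written as \<open>p n\<close> with \<open>p\<close> in a fixed finite set of large primes, so the exceptional \<open>m\<close>
  have density zero.\<close>

subsection \<open>Sieving by squares of primes\<close>

definition periodic_mod :: "nat \<Rightarrow> nat set \<Rightarrow> bool" where
  "periodic_mod q E \<longleftrightarrow> (\<forall>n. n \<in> E \<longleftrightarrow> n mod q \<in> E)"

lemma periodic_modI: "(\<And>n. n \<in> E \<longleftrightarrow> n mod q \<in> E) \<Longrightarrow> periodic_mod q E"
  by (auto simp: periodic_mod_def)

lemma periodic_mod_compl: "periodic_mod q E \<Longrightarrow> periodic_mod q (- E)"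
  by (auto simp: periodic_mod_def)

lemma periodic_mod_dvd:
  assumes "periodic_mod q E" "q dvd r"
  shows "periodic_mod r E"
  using assms unfolding periodic_mod_def by (metis mod_mod_cancel)

text \<open>An element up to \<open>X\<close> is determined by its residue and its block number
  \<open>n div q\<close>; the block numbers run from \<open>0\<close> to \<open>X div q\<close>,
  whence the extra \<open>1\<close>.\<close>

lemma card_periodic_le:
  assumes "periodic_mod q E" "q > 0"
  shows "real (card (E \<inter> {1..X})) \<le> real (card (E \<inter> {..<q})) * (real X / real q + 1)"
proof -
  have "inj_on (\<lambda>n. (n mod q, n div q)) (E \<inter> {1..X})"
    by (auto simp: inj_on_def) (metis div_mult_mod_eq)
  moreover have "(\<lambda>n. (n mod q, n div q)) ` (E \<inter> {1..X}) \<subseteq> (E \<inter> {..<q}) \<times> {..X div q}"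
    using assms by (auto simp: periodic_mod_def div_le_mono)
  ultimately have "card (E \<inter> {1..X}) \<le> card ((E \<inter> {..<q}) \<times> {..X div q})"
    by (intro card_inj_on_le) auto
  also have "\<dots> = card (E \<inter> {..<q}) * (X div q + 1)"
    by (simp add: card_cartesian_product)
  finally have "real (card (E \<inter> {1..X})) \<le> real (card (E \<inter> {..<q}) * (X div q + 1))"
    by (simp only: of_nat_le_iff)
  also have "\<dots> = real (card (E \<inter> {..<q})) * (real (X div q) + 1)"
    by (simp only: of_nat_mult of_nat_add of_nat_1)
  also have "\<dots> \<le> real (card (E \<inter> {..<q})) * (real X / real q + 1)"
    by (intro mult_left_mono) (simp_all add: of_nat_div_le_of_nat)
  finally show ?thesis .
qed

text \<open>The complement of \<open>E\<close> is periodic too, and the upper bound for it turns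
  into a lower bound for \<open>E\<close>.\<close>

lemma card_periodic_ge:
  assumes "periodic_mod q E" "q > 0"
  shows "real (card (E \<inter> {1..X})) \<ge> real (card (E \<inter> {..<q})) * (real X / real q) - real q"
proof -
  have X: "card (E \<inter> {1..X}) + card (- E \<inter> {1..X}) = card {1..X}"
    by (subst card_Un_disjoint [symmetric]) (auto simp flip: Int_Un_distrib2)
  have q: "card (E \<inter> {..<q}) + card (- E \<inter> {..<q}) = card {..<q}"
    by (subst card_Un_disjoint [symmetric]) (auto simp flip: Int_Un_distrib2)
  have "real (card (- E \<inter> {1..X})) \<le> real (card (- E \<inter> {..<q})) * (real X / real q + 1)"
    using card_periodic_le [OF periodic_mod_compl] assms by blast
  moreover have "real (card (- E \<inter> {1..X})) = real X - real (card (E \<inter> {1..X}))"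
    using arg_cong [OF X, of real] by simp
  moreover have "real (card (- E \<inter> {..<q})) = real q - real (card (E \<inter> {..<q}))"
    using arg_cong [OF q, of real] by simp
  ultimately have "real X - real (card (E \<inter> {1..X})) \<le>
      (real q - real (card (E \<inter> {..<q}))) * (real X / real q + 1)"
    by (simp only:)
  also have "\<dots> = real X + real q - card (E \<inter> {..<q}) * (real X / real q) - card (E \<inter> {..<q})"
    using assms(2) by (simp add: field_simps)
  finally show ?thesis by simp
qed

lemma periodic_density:
  assumes "periodic_mod q E" "q > 0"
  shows "convergent (\<lambda>X. real (card (E \<inter> {1..X})) / real X)"
proof -
  define c where "c = real (card (E \<inter> {..<q}))"
  have lim: "(\<lambda>X. a + b / real X) \<longlonglongrightarrow> a" for a b :: real
    by real_asymp
  have "eventually (\<lambda>X. c / q + (- real q) / real X \<le> real (card (E \<inter> {1..X})) / real X) sequentially"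
    using eventually_gt_at_top [of 0]
  proof eventually_elim
    case (elim X)
    then have "c / q + (- real q) / real X = (c * (real X / q) - q) / real X"
      using assms by (simp add: field_simps)
    with card_periodic_ge [OF assms, of X] show ?case
      by (simp add: c_def divide_right_mono)
  qed
  moreover have "eventually (\<lambda>X. real (card (E \<inter> {1..X})) / real X \<le> c / q + c / real X) sequentially"
    using eventually_gt_at_top [of 0]
  proof eventually_elim
    case (elim X)
    then have "c / q + c / real X = (c * (real X / q + 1)) / real X"
      using assms by (simp add: field_simps)
    with card_periodic_le [OF assms, of X] show ?case
      by (simp add: c_def divide_right_mono)
  qed
  ultimately have "(\<lambda>X. real (card (E \<inter> {1..X})) / real X) \<longlonglongrightarrow> c / q"
    by (rule tendsto_sandwich [OF _ _ lim lim])
  then show ?thesis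
    by (rule convergentI)
qed

section \<open>Euler products and integers with a small totient ratio\<close>

text \<open>This is a finite form of Euler's product. In the induction each \<open>n\<close> is
  split into its power of \<open>p\<close> and a cofactor prime to \<open>p\<close>; the powers
  contribute at most the full geometric series, and the cofactors only involve primes of
  \<open>S\<close>.\<close>

lemma sum_inverse_smooth_le:
  fixes S T :: "nat set"
  assumes "finite S" "\<And>p. p \<in> S \<Longrightarrow> prime p" "finite T"
    and "\<And>n. n \<in> T \<Longrightarrow> n > 0 \<and> prime_factors n \<subseteq> S"
  shows "(\<Sum>n\<in>T. 1 / real n) \<le> (\<Prod>p\<in>S. 1 / (1 - 1 / real p))"
  using assms
proof (induction S arbitrary: T rule: finite_induct)
  case empty
  then have "T \<subseteq> {1}"
    by (auto simp: prime_factorization_empty_iff)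
  then have "(\<Sum>n\<in>T. 1 / real n) \<le> (\<Sum>n\<in>{1}. 1 / real n)"
    by (intro sum_mono2) auto
  then show ?case by simp
next
  case (insert p S)
  have p: "prime p" "p > 1"
    using insert.prems prime_gt_1_nat by auto
  define g where "g n = (multiplicity p n, n div p ^ multiplicity p n)" for n :: nat
  define T' where "T' = snd ` g ` T"
  define V where "V = fst ` g ` T"
  have g_eq: "p ^ fst (g n) * snd (g n) = n" for n
    by (simp add: g_def multiplicity_dvd)
  have "(\<Sum>n\<in>T. 1 / real n) = (\<Sum>n\<in>T. (1 / real p) ^ fst (g n) * (1 / real (snd (g n))))"
  proof (intro sum.cong refl)
    fix n
    have "1 / real n = 1 / real (p ^ fst (g n) * snd (g n))"
      by (simp only: g_eq)
    then show "1 / real n = (1 / real p) ^ fst (g n) * (1 / real (snd (g n)))"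
      by (simp add: field_simps)
  qed
  also have "\<dots> = (\<Sum>x\<in>g ` T. (1 / real p) ^ fst x * (1 / real (snd x)))"
    by (rule sum.reindex_cong [symmetric, OF _ refl refl]) (metis g_eq inj_onI)
  \<comment> \<open>The set of pairs is enlarged to the product of its projections, over which the
    nonnegative sum factors.\<close>
  also have "\<dots> \<le> (\<Sum>x\<in>V \<times> T'. (1 / real p) ^ fst x * (1 / real (snd x)))"
    using insert.prems(2)
    unfolding V_def T'_def by (intro sum_mono2 subset_fst_snd) auto
  also have "\<dots> = (\<Sum>v\<in>V. (1 / real p) ^ v) * (\<Sum>m\<in>T'. 1 / real m)"
    by (simp add: sum_product sum.cartesian_product case_prod_beta)
  also have "\<dots> \<le> (1 / (1 - 1 / real p)) * (\<Prod>p\<in>S. 1 / (1 - 1 / real p))"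
  proof (intro mult_mono)
    have "summable (\<lambda>v. (1 / real p) ^ v)" and eq: "(\<Sum>v. (1 / real p) ^ v) = 1 / (1 - 1 / real p)"
      using p by (auto intro!: summable_geometric simp: suminf_geometric)
    moreover have "finite V"
      using insert.prems(2) by (simp add: V_def)
    ultimately show "(\<Sum>v\<in>V. (1 / real p) ^ v) \<le> 1 / (1 - 1 / real p)"
      unfolding eq [symmetric] by (intro sum_le_suminf) auto
    show "(\<Sum>m\<in>T'. 1 / real m) \<le> (\<Prod>p\<in>S. 1 / (1 - 1 / real p))"
    proof (rule insert.IH)
      fix m assume "m \<in> T'"
      then obtain n where n: "n \<in> T" "m = n div p ^ multiplicity p n"
        by (auto simp: T'_def g_def)
      have n0: "n > 0" "prime_factors n \<subseteq> insert p S"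
        using insert.prems(3) n(1) by auto
      have mn: "m dvd n"
        using g_eq [of n] n(2) by (metis dvd_triv_right g_def snd_conv)
      have "m > 0"
        using g_eq [of n] n0 n(2) by (auto simp: g_def intro: Nat.gr0I)
      moreover have "\<not> p dvd m"
        using n(2) n0 p multiplicity_decompose [of n p] by (simp add: not_prime_unit)
      moreover have "prime_factors m \<subseteq> prime_factors n"
        using n0 mn by (intro dvd_prime_factors) auto
      ultimately show "m > 0 \<and> prime_factors m \<subseteq> S"
        using n0 by (auto simp: in_prime_factors_iff)
    qed (use insert.prems in \<open>auto simp: T'_def\<close>)
    show "1 / (1 - 1 / real p) \<ge> 0"
      using p by simp
  qed (auto intro: sum_nonneg)
  also have "\<dots> = (\<Prod>p\<in>insert p S. 1 / (1 - 1 / real p))"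
    using insert.hyps by simp
  finally show ?case .
qed

text \<open>The Euler product over the primes up to \<open>N\<close> dominates
  \<open>harm N\<close>, hence is unbounded. Discarding the primes up to \<open>z\<close> costs at
  most the fixed factor \<open>c\<close>, and for the product \<open>Q\<close> of the remaining
  primes the Euler product is exactly \<open>Q / totient Q\<close>.\<close>

lemma ex_totient_ratio_less:
  fixes z :: nat and \<delta> :: real
  assumes "\<delta> > 0"
  obtains Q :: nat where "Q > 0" "\<And>p. p \<in> prime_factors Q \<Longrightarrow> p > z" "real (totient Q) < \<delta> * real Q"
proof -
  define P where "P A = (\<Prod>p\<in>A. 1 / (1 - 1 / real p))" for A :: "nat set"
  define c where "c = P {p. prime p \<and> p \<le> z}"
  have pos: "P A > 0" if "\<And>p. p \<in> A \<Longrightarrow> prime p" for A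
    unfolding P_def using that by (intro prod_pos) (auto dest!: that prime_gt_1_nat)
  have "eventually (\<lambda>n. (harm n :: real) > c / \<delta>) sequentially"
    using harm_at_top by (simp add: filterlim_at_top_dense)
  then obtain N where N: "(harm N :: real) > c / \<delta>"
    by (auto simp: eventually_sequentially)
  define S where "S = {p. prime p \<and> p \<le> N}"
  define S' where "S' = {p. prime p \<and> p \<le> N \<and> z < p}"
  have fin: "finite S" "finite S'" "finite {p. prime p \<and> p \<le> z}"
    by (auto simp: S_def S'_def)
  have "harm N = (\<Sum>n\<in>{1..N}. 1 / real n)"
    by (simp add: harm_def field_simps)
  also have "\<dots> \<le> P S"
    unfolding P_def
    by (rule sum_inverse_smooth_le)
      (use fin in \<open>auto simp: S_def in_prime_factors_iff dest!: dvd_imp_le\<close>)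
  also have "P S = P (S - S') * P S'"
    unfolding P_def by (rule prod.subset_diff) (auto simp: S_def S'_def)
  also have "P (S - S') \<le> c"
    unfolding c_def P_def
  proof (rule prod_mono2)
    show "S - S' \<subseteq> {p. prime p \<and> p \<le> z}"
      by (auto simp: S_def S'_def)
  next
    fix p assume "p \<in> {p. prime p \<and> p \<le> z} - (S - S')"
    then have "prime p" by auto
    then show "1 \<le> 1 / (1 - 1 / real p)"
      using prime_gt_1_nat [of p] by (simp add: field_simps)
  next
    fix p assume "p \<in> S - S'"
    then have "prime p" by (auto simp: S_def)
    then show "0 \<le> 1 / (1 - 1 / real p)"
      using prime_gt_1_nat [of p] by (simp add: field_simps)
  qed (rule fin)
  finally have "harm N \<le> c * P S'"
    using pos [of S'] by (auto simp: S'_def)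
  with N have less: "c / \<delta> < c * P S'"
    by simp
  moreover have "c > 0"
    unfolding c_def by (rule pos) auto
  ultimately have "1 < \<delta> * P S'"
    using assms by (simp add: field_simps)
  define Q where "Q = \<Prod>S'"
  have pf: "prime_factors Q = S'"
    unfolding Q_def using fin
    by (subst prime_factors_prod) (auto simp: S'_def prime_prime_factors)
  have "Q > 0"
    unfolding Q_def by (rule prod_pos) (auto simp: S'_def prime_gt_0_nat)
  moreover have "real (totient Q) = real Q / P S'"
    unfolding totient_formula2 pf P_def by (simp add: prod_dividef)
  moreover have "1 / P S' < \<delta>"
    using \<open>1 < \<delta> * P S'\<close> pos [of S'] by (simp add: S'_def field_simps)
  then have "real Q * (1 / P S') < real Q * \<delta>"
    using \<open>Q > 0\<close> by (intro mult_strict_left_mono) auto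
  ultimately show ?thesis
    using pf by (intro that [of Q]) (auto simp: S'_def mult.commute)
qed

section \<open>The sieve with small, medium and large moduli\<close>

text \<open>Approximation within every \<open>e\<close> transfers the Cauchy property. The
  approximants used below are the proportions left after sieving by finitely many moduli.\<close>

lemma convergent_if_approximated:
  fixes u :: "nat \<Rightarrow> real"
  assumes "\<And>e. e > 0 \<Longrightarrow> \<exists>v. convergent v \<and> eventually (\<lambda>n. \<bar>u n - v n\<bar> \<le> e) sequentially"
  shows "convergent u"
proof (rule Cauchy_convergent, rule metric_CauchyI)
  fix e :: real assume "e > 0"
  then obtain v where v: "convergent v" "eventually (\<lambda>n. \<bar>u n - v n\<bar> \<le> e / 4) sequentially"
    using assms [of "e / 4"] by auto
  then obtain N1 where N1: "\<And>n. n \<ge> N1 \<Longrightarrow> \<bar>u n - v n\<bar> \<le> e / 4"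
    by (auto simp: eventually_sequentially)
  have "Cauchy v"
    using v(1) by (simp add: convergent_Cauchy)
  then obtain N2 where N2: "\<And>m n. m \<ge> N2 \<Longrightarrow> n \<ge> N2 \<Longrightarrow> dist (v m) (v n) < e / 4"
    using metric_CauchyD [of v "e / 4"] \<open>e > 0\<close> by auto
  have "dist (u m) (u n) < e" if "m \<ge> max N1 N2" "n \<ge> max N1 N2" for m n
  proof -
    have "\<bar>u m - v m\<bar> \<le> e / 4" "\<bar>u n - v n\<bar> \<le> e / 4" "\<bar>v m - v n\<bar> < e / 4"
      using N1 [of m] N1 [of n] N2 [of m n] that by (auto simp: dist_real_def)
    then show ?thesis
      unfolding dist_real_def using \<open>e > 0\<close> by linarith
  qed
  then show "\<exists>M. \<forall>m\<ge>M. \<forall>n\<ge>M. dist (u m) (u n) < e"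
    by blast
qed

text \<open>Each term is at most \<open>1 / (p - 1) - 1 / p\<close>, so the sum telescopes.\<close>

lemma sum_inverse_squares_le:
  fixes z Y :: nat
  assumes "z > 0" "z \<le> Y"
  shows "(\<Sum>p\<in>{z<..Y}. 1 / (real p)\<^sup>2) \<le> 1 / real z - 1 / real Y"
  using assms(2)
proof (induction Y rule: dec_induct)
  case (step Y)
  have "1 / (real (Suc Y))\<^sup>2 \<le> 1 / (real Y * real (Suc Y))"
    unfolding power2_eq_square using assms step.hyps
    by (intro divide_left_mono mult_right_mono mult_pos_pos) auto
  also have "\<dots> = 1 / real Y - 1 / real (Suc Y)"
    using assms step.hyps by (simp add: field_simps)
  finally have "1 / (real (Suc Y))\<^sup>2 \<le> 1 / real Y - 1 / real (Suc Y)" .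
  moreover have "{z<..Suc Y} = insert (Suc Y) {z<..Y}"
    using step.hyps by auto
  ultimately show ?case
    using step.IH by simp
qed simp

lemma le_power2_if_cube_le: "(p :: nat) ^ 3 \<le> X\<^sup>2 \<Longrightarrow> p \<le> X\<^sup>2"
  by (cases "p = 0") (auto intro: order.trans [OF self_le_power [of _ 3]])

context
  fixes P :: "nat set" and E :: "nat \<Rightarrow> nat set" and r :: "nat \<Rightarrow> nat" and K :: nat
  assumes zero: "0 \<notin> P"
    and periodic: "\<And>p. p \<in> P \<Longrightarrow> periodic_mod (p\<^sup>2) (E p)"
    and card_le: "\<And>p. p \<in> P \<Longrightarrow> card (E p \<inter> {..<p\<^sup>2}) \<le> r p"
    and bounded: "\<And>p. p \<in> P \<Longrightarrow> r p \<le> K"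
begin

lemma finite_medium: "finite {p\<in>P. z < p \<and> p ^ 3 \<le> X\<^sup>2}"
proof (rule finite_subset)
  show "{p\<in>P. z < p \<and> p ^ 3 \<le> X\<^sup>2} \<subseteq> {..X\<^sup>2}"
    using le_power2_if_cube_le by auto
qed simp

text \<open>Each \<open>p\<close> costs its main term and an error of at most \<open>K\<close>. At
  most \<open>X^(2/3)\<close> elements satisfy \<open>p^3 <= X^2\<close>, so the errors add up to
  \<open>o(X)\<close>. Any cutoff exponent below \<open>1\<close> would serve here; the abc argument
  needs one above \<open>1/2\<close>.\<close>

lemma card_medium_le:
  "real (card {n\<in>{1..X}. \<exists>p\<in>P. z < p \<and> p ^ 3 \<le> X\<^sup>2 \<and> n \<in> E p})
     \<le> real X * (\<Sum>p\<in>{p\<in>P. z < p \<and> p ^ 3 \<le> X\<^sup>2}. real (r p) / (real p)\<^sup>2) + K * real X powr (2/3)"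
proof -
  define A where "A = {p\<in>P. z < p \<and> p ^ 3 \<le> X\<^sup>2}"
  have fin: "finite A"
    unfolding A_def by (rule finite_medium)
  have "{n\<in>{1..X}. \<exists>p\<in>P. z < p \<and> p ^ 3 \<le> X\<^sup>2 \<and> n \<in> E p} = (\<Union>p\<in>A. E p \<inter> {1..X})"
    by (auto simp: A_def)
  then have "real (card {n\<in>{1..X}. \<exists>p\<in>P. z < p \<and> p ^ 3 \<le> X\<^sup>2 \<and> n \<in> E p})
      \<le> (\<Sum>p\<in>A. real (card (E p \<inter> {1..X})))"
    using card_UN_le [OF fin, of "\<lambda>p. E p \<inter> {1..X}"] by (simp flip: of_nat_sum)
  also have "\<dots> \<le> (\<Sum>p\<in>A. real X * (real (r p) / (real p)\<^sup>2) + real K)"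
  proof (intro sum_mono)
    fix p assume "p \<in> A"
    then have p: "p \<in> P" "p > 0"
      using zero by (auto simp: A_def intro!: Nat.gr0I)
    have "real (card (E p \<inter> {1..X})) \<le> real (card (E p \<inter> {..<p\<^sup>2})) * (real X / real (p\<^sup>2) + 1)"
      using p by (intro card_periodic_le periodic) auto
    also have "\<dots> \<le> real (r p) * (real X / real (p\<^sup>2) + 1)"
      using p card_le by (intro mult_right_mono) auto
    also have "\<dots> \<le> real X * (real (r p) / (real p)\<^sup>2) + real K"
      using bounded [OF p(1)] by (simp add: field_simps)
    finally show "real (card (E p \<inter> {1..X})) \<le> real X * (real (r p) / (real p)\<^sup>2) + real K" .
  qed
  also have "\<dots> = real X * (\<Sum>p\<in>A. real (r p) / (real p)\<^sup>2) + K * real (card A)"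
    by (simp add: sum.distrib sum_distrib_left)
  also have "real (card A) \<le> real X powr (2/3)"
  proof -
    have "A \<subseteq> {1..nat \<lfloor>real X powr (2/3)\<rfloor>}"
    proof
      fix p assume p: "p \<in> A"
      then have "p > 0" "p ^ 3 \<le> X\<^sup>2"
        using zero by (auto simp: A_def intro!: Nat.gr0I)
      then have "real p ^ 3 \<le> real X ^ 2"
        by (metis of_nat_mono of_nat_power)
      then have "(real p ^ 3) powr (1/3) \<le> (real X ^ 2) powr (1/3)"
        by (intro powr_mono2) auto
      moreover have "(real p ^ 3) powr (1/3) = real p"
        using \<open>p > 0\<close> by (simp add: powr_powr flip: powr_numeral)
      moreover have "X > 0"
        using \<open>p ^ 3 \<le> X\<^sup>2\<close> \<open>p > 0\<close> by (auto intro!: Nat.gr0I)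
      then have "(real X ^ 2) powr (1/3) = real X powr (2/3)"
        by (simp add: powr_powr flip: powr_numeral)
      ultimately show "p \<in> {1..nat \<lfloor>real X powr (2/3)\<rfloor>}"
        using \<open>p > 0\<close> by (simp add: le_nat_floor)
    qed
    then have "card A \<le> nat \<lfloor>real X powr (2/3)\<rfloor>"
      using card_mono [of "{1..nat \<lfloor>real X powr (2/3)\<rfloor>}" A] by simp
    then have "real (card A) \<le> real (nat \<lfloor>real X powr (2/3)\<rfloor>)"
      by (simp only: of_nat_le_iff)
    also have "\<dots> \<le> real X powr (2/3)"
      by (rule of_nat_floor) simp
    finally show ?thesis .
  qed
  finally show ?thesis
    by (simp add: A_def mult_left_mono)
qed

lemma card_avoiding_ge:
  "real (card {n\<in>{1..X}. \<forall>p\<in>P. n \<notin> E p})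
     \<ge> real (card {n\<in>{1..X}. \<forall>p\<in>P. p \<le> z \<longrightarrow> n \<notin> E p})
       - real X * (\<Sum>p\<in>{p\<in>P. z < p \<and> p ^ 3 \<le> X\<^sup>2}. real (r p) / (real p)\<^sup>2)
       - K * real X powr (2/3)
       - real (card {n\<in>{1..X}. \<exists>p\<in>P. p ^ 3 > X\<^sup>2 \<and> n \<in> E p})"
proof -
  let ?U = "{n\<in>{1..X}. \<forall>p\<in>P. n \<notin> E p}"
  let ?M = "{n\<in>{1..X}. \<exists>p\<in>P. z < p \<and> p ^ 3 \<le> X\<^sup>2 \<and> n \<in> E p}"
  let ?L = "{n\<in>{1..X}. \<exists>p\<in>P. p ^ 3 > X\<^sup>2 \<and> n \<in> E p}"
  have "{n\<in>{1..X}. \<forall>p\<in>P. p \<le> z \<longrightarrow> n \<notin> E p} \<subseteq> ?U \<union> ?M \<union> ?L"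
    by (auto simp: not_le not_less) (metis not_le)
  then have "card {n\<in>{1..X}. \<forall>p\<in>P. p \<le> z \<longrightarrow> n \<notin> E p} \<le> card (?U \<union> ?M \<union> ?L)"
    by (intro card_mono) auto
  also have "\<dots> \<le> card ?U + card ?M + card ?L"
    using card_Un_le [of "?U \<union> ?M" ?L] card_Un_le [of ?U ?M] by linarith
  finally have "real (card {n\<in>{1..X}. \<forall>p\<in>P. p \<le> z \<longrightarrow> n \<notin> E p})
      \<le> real (card ?U) + real (card ?M) + real (card ?L)"
    by (simp flip: of_nat_add)
  with card_medium_le [of X z] show ?thesis
    by simp
qed

text \<open>The density \<open>v z\<close> after sieving up to \<open>z\<close> exists by
  periodicity, and it differs from the proportion sought by a tail that is small uniformly in
  \<open>X\<close> once \<open>z\<close> is large; hence the limit exists. The same comparison at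
  \<open>z = 0\<close> gives the lower bound.\<close>

theorem sieve_density:
  assumes sum_le: "\<And>z. (\<Sum>p\<in>{p\<in>P. p \<le> z}. real (r p) / (real p)\<^sup>2) \<le> s"
    and large: "\<And>\<delta> :: real. \<delta> > 0 \<Longrightarrow>
      eventually (\<lambda>X. real (card {n\<in>{1..X}. \<exists>p\<in>P. p ^ 3 > X\<^sup>2 \<and> n \<in> E p}) \<le> \<delta> * real X) sequentially"
  obtains \<kappa> where "\<kappa> \<ge> 1 - s"
    "(\<lambda>X. real (card {n\<in>{1..X}. \<forall>p\<in>P. n \<notin> E p}) / real X) \<longlonglongrightarrow> \<kappa>"
proof -
  define u where "u X = real (card {n\<in>{1..X}. \<forall>p\<in>P. n \<notin> E p}) / real X" for X
  define v where "v z X = real (card {n\<in>{1..X}. \<forall>p\<in>P. p \<le> z \<longrightarrow> n \<notin> E p}) / real X" for z X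
  define t where "t z X = (\<Sum>p\<in>{p\<in>P. z < p \<and> p ^ 3 \<le> X\<^sup>2}. real (r p) / (real p)\<^sup>2)" for z X
  have key: "eventually (\<lambda>X. u X \<ge> v z X - t z X - \<delta>) sequentially" if "\<delta> > 0" for z and \<delta> :: real
  proof -
    have "eventually (\<lambda>X. K * real X powr (2/3) \<le> \<delta> / 2 * real X) sequentially"
      using that by real_asymp
    moreover have "eventually (\<lambda>X. real (card {n\<in>{1..X}. \<exists>p\<in>P. p ^ 3 > X\<^sup>2 \<and> n \<in> E p}) \<le> \<delta> / 2 * real X) sequentially"
      using that by (intro large) auto
    ultimately show ?thesis
      using eventually_gt_at_top [of 0]
    proof eventually_elim
      case (elim X)
      have "real X * u X \<ge> real X * v z X - real X * t z X - \<delta> * real X"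
        using card_avoiding_ge [where z = z and X = X] elim by (simp add: u_def v_def t_def)
      then have "real X * (v z X - t z X - \<delta>) \<le> real X * u X"
        by (simp add: algebra_simps)
      with elim show ?case
        by (simp add: mult_le_cancel_left_pos)
    qed
  qed
  have "convergent (v z)" for z
  proof -
    define S where "S = {p\<in>P. p \<le> z}"
    have "periodic_mod (\<Prod>p\<in>S. p\<^sup>2) {n. \<forall>p\<in>P. p \<le> z \<longrightarrow> n \<notin> E p}"
    proof (rule periodic_modI)
      fix n
      have "n \<in> E p \<longleftrightarrow> n mod (\<Prod>p\<in>S. p\<^sup>2) \<in> E p" if "p \<in> P" "p \<le> z" for p
      proof -
        have "periodic_mod (\<Prod>p\<in>S. p\<^sup>2) (E p)"
          using that by (intro periodic_mod_dvd [OF periodic] dvd_prodI) (auto simp: S_def)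
        then show ?thesis
          by (auto simp: periodic_mod_def)
      qed
      then show "n \<in> {n. \<forall>p\<in>P. p \<le> z \<longrightarrow> n \<notin> E p} \<longleftrightarrow>
          n mod (\<Prod>p\<in>S. p\<^sup>2) \<in> {n. \<forall>p\<in>P. p \<le> z \<longrightarrow> n \<notin> E p}"
        by blast
    qed
    moreover have "(\<Prod>p\<in>S. p\<^sup>2) > 0"
      using zero by (intro prod_pos) (auto simp: S_def intro!: Nat.gr0I)
    ultimately have "convergent (\<lambda>X. real (card ({n. \<forall>p\<in>P. p \<le> z \<longrightarrow> n \<notin> E p} \<inter> {1..X})) / real X)"
      by (rule periodic_density)
    moreover have "{n. \<forall>p\<in>P. p \<le> z \<longrightarrow> n \<notin> E p} \<inter> {1..X} = {n\<in>{1..X}. \<forall>p\<in>P. p \<le> z \<longrightarrow> n \<notin> E p}" for X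
      by auto
    ultimately show ?thesis
      by (simp add: v_def [abs_def])
  qed
  moreover have "\<exists>z. eventually (\<lambda>X. \<bar>u X - v z X\<bar> \<le> e) sequentially" if "e > 0" for e :: real
  proof -
    \<comment> \<open>The tail of the sum beyond \<open>z\<close> is at most \<open>K / z\<close>,
      so this choice keeps it below \<open>e / 2\<close>.\<close>
    obtain z :: nat where z: "real z > 2 * real K / e"
      using reals_Archimedean2 by blast
    moreover have "2 * real K / e \<ge> 0"
      using that by simp
    ultimately have "z > 0"
      by (auto intro!: Nat.gr0I)
    have t_le: "t z X \<le> e / 2" for X
    proof -
      have "t z X \<le> (\<Sum>p\<in>{p\<in>P. z < p \<and> p ^ 3 \<le> X\<^sup>2}. real K * (1 / (real p)\<^sup>2))"
        unfolding t_def using bounded by (intro sum_mono) (auto intro: divide_right_mono)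
      also have "\<dots> \<le> (\<Sum>p\<in>{z<..z + X\<^sup>2}. real K * (1 / (real p)\<^sup>2))"
        using le_power2_if_cube_le
        by (intro sum_mono2) (auto intro: trans_le_add2 simp: subset_iff)
      also have "\<dots> = real K * (\<Sum>p\<in>{z<..z + X\<^sup>2}. 1 / (real p)\<^sup>2)"
        by (rule sum_distrib_left [symmetric])
      also have "(\<Sum>p\<in>{z<..z + X\<^sup>2}. 1 / (real p)\<^sup>2) \<le> 1 / real z - 1 / real (z + X\<^sup>2)"
        by (rule sum_inverse_squares_le) (use \<open>z > 0\<close> in auto)
      also have "\<dots> \<le> 1 / real z"
        by simp
      also have "real K * (1 / real z) \<le> e / 2"
        using z \<open>z > 0\<close> that by (simp add: field_simps)
      finally show ?thesis
        by (simp add: mult_left_mono)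
    qed
    have "eventually (\<lambda>X. \<bar>u X - v z X\<bar> \<le> e) sequentially"
    proof (rule eventually_mono [OF key [of "e / 2" z]])
      fix X assume "v z X - t z X - e / 2 \<le> u X"
      moreover have "u X \<le> v z X"
        unfolding u_def v_def by (intro divide_right_mono of_nat_mono card_mono) auto
      ultimately show "\<bar>u X - v z X\<bar> \<le> e"
        using t_le [of X] by simp
    qed (use that in simp)
    then show ?thesis ..
  qed
  ultimately have "convergent u"
    by (intro convergent_if_approximated) blast
  then obtain \<kappa> where \<kappa>: "u \<longlonglongrightarrow> \<kappa>"
    by (auto simp: convergent_def)
  have "1 - s - \<delta> \<le> \<kappa>" if "\<delta> > 0" for \<delta> :: real
  proof (rule tendsto_lowerbound [OF \<kappa>])
    show "eventually (\<lambda>X. 1 - s - \<delta> \<le> u X) sequentially"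
      \<comment> \<open>At \<open>z = 0\<close> nothing has been sieved yet, because
        \<open>0\<close> is not in \<open>P\<close>: the proportion \<open>v 0 X\<close> is
        \<open>1\<close>, and the sum subtracted from it is at most \<open>s\<close>.\<close>
      using key [OF that, of 0] eventually_gt_at_top [of 0]
    proof eventually_elim
      case (elim X)
      have "t 0 X \<le> (\<Sum>p\<in>{p\<in>P. p \<le> X\<^sup>2}. real (r p) / (real p)\<^sup>2)"
        unfolding t_def using le_power2_if_cube_le
        by (intro sum_mono2) auto
      also have "\<dots> \<le> s"
        by (rule sum_le)
      finally have "t 0 X \<le> s" .
      moreover have "{n\<in>{1..X}. \<forall>p\<in>P. p \<le> 0 \<longrightarrow> n \<notin> E p} = {1..X}"
        using zero by auto
      then have "v 0 X = 1"
        using elim by (simp add: v_def)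
      ultimately show ?case
        using elim by simp
    qed
  qed simp
  then have "1 - s \<le> \<kappa> + \<delta>" if "\<delta> > 0" for \<delta> :: real
    using that by (simp add: diff_le_eq)
  then have "1 - s \<le> \<kappa>"
    by (rule field_le_epsilon)
  with \<kappa> show ?thesis
    unfolding u_def [abs_def] by (intro that)
qed

end

section \<open>Multiplicatively sparse sets have density zero\<close>

lemma card_coprime_le:
  assumes "Q > 0"
  shows "card ({n. coprime n Q} \<inter> {..<Q}) \<le> totient Q"
proof (cases "Q = 1")
  case False
  then have "{n. coprime n Q} \<inter> {..<Q} \<subseteq> totatives Q"
    using assms by (auto simp: totatives_def intro!: Nat.gr0I)
  then show ?thesis
    unfolding totient_def by (intro card_mono) auto
qed auto

text \<open>Dividing an element by some prime factor from a fixed finite set of primes above \<open>z\<close> is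
  essentially injective, and almost all integers have such a factor.\<close>

lemma multiplicatively_sparse_density_zero:
  fixes G :: "nat \<Rightarrow> bool" and \<delta> :: real
  assumes sparse: "\<And>a b. prime a \<Longrightarrow> prime b \<Longrightarrow> odd a \<Longrightarrow> odd b \<Longrightarrow> a \<noteq> b \<Longrightarrow>
      eventually (\<lambda>n. \<not> (G (a * n) \<and> G (b * n))) sequentially"
    and "\<delta> > 0"
  shows "eventually (\<lambda>X. real (card {n\<in>{1..X}. G n}) \<le> \<delta> * real X) sequentially"
proof -
  obtain z0 :: nat where z0: "real z0 > 4 / \<delta>"
    using reals_Archimedean2 by blast
  define z where "z = z0 + 2"
  have z: "real z > 4 / \<delta>" "z \<ge> 2"
    using z0 by (auto simp: z_def)
  \<comment> \<open>The integers coprime to \<open>Q\<close> have density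
    \<open>totient Q / Q\<close>, below \<open>\<delta> / 4\<close>; all others share with
    \<open>Q\<close> a prime above \<open>z\<close>, which is odd because \<open>z\<close> is at
    least \<open>2\<close>.\<close>
  obtain Q :: nat where Q: "Q > 0" "\<And>p. p \<in> prime_factors Q \<Longrightarrow> p > z" "real (totient Q) < \<delta> / 4 * real Q"
    using ex_totient_ratio_less [of "\<delta> / 4" z] \<open>\<delta> > 0\<close> by auto
  define S where "S = prime_factors Q"
  have S: "prime p" "p > z" "odd p" "p \<le> Q" if "p \<in> S" for p
  proof -
    show "prime p" "p > z"
      using that Q(2) by (auto simp: S_def)
    then show "odd p"
      using z(2) prime_odd_nat by simp
    show "p \<le> Q"
      using that Q(1) by (auto simp: S_def in_prime_factors_iff dest: dvd_imp_le)
  qed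
  \<comment> \<open>As \<open>S\<close> is finite, one threshold \<open>n0\<close> serves all pairs
    of its primes.\<close>
  have "eventually (\<lambda>n. \<forall>a\<in>S. \<forall>b\<in>S. a \<noteq> b \<longrightarrow> \<not> (G (a * n) \<and> G (b * n))) sequentially"
    using sparse S by (intro eventually_ball_finite ballI) (auto simp: S_def)
  then obtain n0 where n0: "\<And>n a b. n \<ge> n0 \<Longrightarrow> a \<in> S \<Longrightarrow> b \<in> S \<Longrightarrow> G (a * n) \<Longrightarrow> G (b * n) \<Longrightarrow> a = b"
    by (auto simp: eventually_sequentially)
  have bound: "real (card {n\<in>{1..X}. G n}) \<le> \<delta> / 2 * real X + (real (totient Q) + real (Q * n0))" for X
  proof -
    \<comment> \<open>These have a prime factor in \<open>S\<close> with a cofactor of at least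
      \<open>n0\<close>. An integer whose cofactor is smaller lies below \<open>Q * n0\<close>, so
      such integers contribute only a constant.\<close>
    define D where "D = {n\<in>{1..X}. G n \<and> (\<exists>p\<in>S. p dvd n \<and> n div p \<ge> n0)}"
    have "{n\<in>{1..X}. G n} \<subseteq> ({n. coprime n Q} \<inter> {1..X}) \<union> {..<Q * n0} \<union> D"
    proof
      fix n assume n: "n \<in> {n\<in>{1..X}. G n}"
      show "n \<in> ({n. coprime n Q} \<inter> {1..X}) \<union> {..<Q * n0} \<union> D"
      proof (cases "coprime n Q")
        case False
        then obtain p where p: "prime p" "p dvd n" "p dvd Q"
          by (metis coprime_iff_gcd_eq_1 dvd_trans gcd_dvd1 gcd_dvd2 prime_factor_nat)
        then have "p \<in> S"
          using Q(1) by (simp add: S_def in_prime_factors_iff)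
        show ?thesis
        proof (cases "n div p \<ge> n0")
          case True
          with n p \<open>p \<in> S\<close> show ?thesis
            by (auto simp: D_def)
        next
          case False
          have "n = p * (n div p)"
            using p by simp
          also have "\<dots> < Q * n0"
            using False S(4) [OF \<open>p \<in> S\<close>] p(1)
            by (intro mult_le_less_imp_less) (auto simp: prime_gt_0_nat)
          finally show ?thesis by simp
        qed
      qed (use n in auto)
    qed
    then have "card {n\<in>{1..X}. G n} \<le> card (({n. coprime n Q} \<inter> {1..X}) \<union> {..<Q * n0} \<union> D)"
      by (intro card_mono) (auto simp: D_def)
    also have "\<dots> \<le> card ({n. coprime n Q} \<inter> {1..X}) + Q * n0 + card D"
      using card_Un_le [of "({n. coprime n Q} \<inter> {1..X}) \<union> {..<Q * n0}" D]
        card_Un_le [of "{n. coprime n Q} \<inter> {1..X}" "{..<Q * n0}"] by simp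
    finally have "real (card {n\<in>{1..X}. G n}) \<le>
        real (card ({n. coprime n Q} \<inter> {1..X})) + real (Q * n0) + real (card D)"
      by (metis of_nat_add of_nat_mono)
    moreover have "real (card ({n. coprime n Q} \<inter> {1..X})) \<le> \<delta> / 4 * real X + real (totient Q)"
    proof -
      have "periodic_mod Q {n. coprime n Q}"
        by (rule periodic_modI) (metis coprime_iff_gcd_eq_1 gcd.commute gcd_red_nat mem_Collect_eq)
      then have "real (card ({n. coprime n Q} \<inter> {1..X}))
          \<le> real (card ({n. coprime n Q} \<inter> {..<Q})) * (real X / real Q + 1)"
        using Q(1) by (rule card_periodic_le)
      also have "\<dots> \<le> real (totient Q) * (real X / real Q + 1)"
        using card_coprime_le [OF Q(1)] by (intro mult_right_mono) auto
      also have "\<dots> = real (totient Q) / real Q * real X + real (totient Q)"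
        by (simp add: algebra_simps)
      also have "real (totient Q) / real Q * real X \<le> \<delta> / 4 * real X"
        using Q by (intro mult_right_mono) (auto simp: field_simps)
      finally show ?thesis by simp
    qed
    moreover have "real (card D) \<le> \<delta> / 4 * real X"
    proof -
      have "\<exists>p. p \<in> S \<and> p dvd n \<and> n div p \<ge> n0" if "n \<in> D" for n
        using that by (auto simp: D_def)
      then obtain \<pi> where \<pi>: "\<And>n. n \<in> D \<Longrightarrow> \<pi> n \<in> S \<and> \<pi> n dvd n \<and> n div \<pi> n \<ge> n0"
        by metis
      \<comment> \<open>Two elements with the same cofactor but different chosen primes would
        contradict the choice of \<open>n0\<close>.\<close>
      have "inj_on (\<lambda>n. n div \<pi> n) D"
      proof (rule inj_onI)
        fix m n assume mn: "m \<in> D" "n \<in> D" and eq: "m div \<pi> m = n div \<pi> n"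
        have "m = \<pi> m * (m div \<pi> m)" "n = \<pi> n * (m div \<pi> m)"
          using \<pi> mn eq by (metis dvd_mult_div_cancel)+
        moreover from this have "\<pi> m = \<pi> n"
          using n0 [of "m div \<pi> m" "\<pi> m" "\<pi> n"] \<pi> mn by (auto simp: D_def)
        ultimately show "m = n"
          by metis
      qed
      moreover have "(\<lambda>n. n div \<pi> n) ` D \<subseteq> {1..X div z}"
      proof safe
        fix n assume "n \<in> D"
        then have n: "\<pi> n \<in> S" "\<pi> n dvd n" "n \<ge> 1" "n \<le> X"
          using \<pi> by (auto simp: D_def)
        \<comment> \<open>The chosen prime exceeds \<open>z\<close>, so there are at most
          \<open>X div z\<close> cofactors, and \<open>1 / z\<close> is below
          \<open>\<delta> / 4\<close>.\<close>
        have "n div \<pi> n \<le> n div z"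
          using S(2) [OF n(1)] z(2) by (intro div_le_mono2) auto
        also have "\<dots> \<le> X div z"
          using n by (intro div_le_mono)
        finally show "n div \<pi> n \<in> {1..X div z}"
          using n by (auto simp: Suc_le_eq div_greater_zero_iff dvd_imp_le intro!: Nat.gr0I)
      qed
      ultimately have "card D \<le> X div z"
        using card_inj_on_le [of "\<lambda>n. n div \<pi> n" D "{1..X div z}"] by simp
      then have "real (card D) \<le> real X / real z"
        by (meson of_nat_div_le_of_nat of_nat_mono order.trans)
      also have "\<dots> = (1 / real z) * real X"
        by simp
      also have "\<dots> \<le> \<delta> / 4 * real X"
        using z \<open>\<delta> > 0\<close> by (intro mult_right_mono) (auto simp: field_simps)
      finally show ?thesis .
    qed
    ultimately show ?thesis by linarith
  qed
  have "eventually (\<lambda>X. \<delta> / 2 * real X + (real (totient Q) + real (Q * n0)) \<le> \<delta> * real X) sequentially"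
    using \<open>\<delta> > 0\<close> by real_asymp
  then show ?thesis
    by (rule eventually_mono) (rule order.trans [OF bound])
qed

subsection \<open>Consequences of the abc conjecture\<close>

definition radical :: "nat \<Rightarrow> nat" where
  "radical n = (\<Prod>p | prime p \<and> p dvd n. p)"

lemma finite_prime_divisors_nat: "n > 0 \<Longrightarrow> finite {p :: nat. prime p \<and> p dvd n}"
  by (rule finite_subset [of _ "{..n}"]) (auto dest: dvd_imp_le)

lemma radical_mono:
  assumes "n > 0" "\<And>p. prime p \<Longrightarrow> p dvd m \<Longrightarrow> p dvd n"
  shows "radical m \<le> radical n"
  unfolding radical_def
proof (rule dvd_imp_le)
  show "\<Prod>{p. prime p \<and> p dvd m} dvd \<Prod>{p. prime p \<and> p dvd n}"
    using assms by (intro prod_dvd_prod_subset finite_prime_divisors_nat) auto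
  show "0 < \<Prod>{p. prime p \<and> p dvd n}"
    by (rule prod_pos) (auto simp: prime_gt_0_nat)
qed

lemma radical_mult_le:
  assumes "m > 0" "n > 0"
  shows "radical (m * n) \<le> radical m * radical n"
proof -
  let ?A = "{p. prime p \<and> p dvd m}" and ?B = "{p. prime p \<and> p dvd n}"
  have fin: "finite ?A" "finite ?B"
    using assms finite_prime_divisors_nat by auto
  have "{p. prime p \<and> p dvd m * n} = ?A \<union> ?B"
    by (auto simp: prime_dvd_mult_iff)
  moreover have "\<Prod>(?A \<union> ?B) * 1 \<le> \<Prod>(?A \<union> ?B) * \<Prod>(?A \<inter> ?B)"
    by (intro mult_le_mono order.refl prod_ge_1) (auto dest: prime_gt_0_nat)
  moreover have "\<Prod>(?A \<union> ?B) * \<Prod>(?A \<inter> ?B) = \<Prod>?A * \<Prod>?B"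
    using fin by (rule prod.union_inter)
  ultimately show ?thesis
    by (simp add: radical_def)
qed

lemma radical_le: "n > 0 \<Longrightarrow> radical n \<le> n"
proof -
  assume n: "n > 0"
  have "radical n = \<Prod>(prime_factors n)"
    using n by (auto simp: radical_def prime_factors_dvd intro: prod.cong)
  also have "\<dots> \<le> (\<Prod>p\<in>prime_factors n. p ^ multiplicity p n)"
  proof (intro prod_mono conjI)
    fix p assume "p \<in> prime_factors n"
    then show "p \<le> p ^ multiplicity p n"
      using n by (intro self_le_power) (auto simp: prime_factors_multiplicity prime_ge_Suc_0_nat)
  qed simp
  also have "\<dots> = n"
    using n by (simp add: prod_prime_factors)
  finally show ?thesis .
qed

lemma radical_power_le: "n > 0 \<Longrightarrow> radical (n ^ k) \<le> radical n"
  by (rule radical_mono) (auto dest: prime_dvd_power)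

text \<open>With \<open>n = q^2 * t\<close> every prime of \<open>n\<close> already divides
  \<open>q * t\<close>, which saves a factor \<open>q\<close>. This saving is what a large square
  divisor contributes to the abc argument.\<close>

lemma radical_times_prime_le:
  assumes "n > 0" "prime q" "q\<^sup>2 dvd n"
  shows "radical n * q \<le> n"
proof -
  obtain t where t: "n = q\<^sup>2 * t"
    using assms by auto
  have "radical n \<le> radical (q * t)"
    using assms t by (intro radical_mono) (auto simp: prime_dvd_mult_iff power2_eq_square)
  also have "\<dots> \<le> q * t"
    using assms t by (intro radical_le) (auto intro!: Nat.gr0I)
  finally show ?thesis
    using t by (simp add: power2_eq_square mult.assoc mult.commute)
qed

text \<open>After division by \<open>gcd a b\<close> the conjecture applies, the radical does not
  grow, and multiplying back costs a factor of at most \<open>a\<close>. In the application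
  \<open>a\<close> stays fixed while \<open>b\<close> varies, so the loss is a constant.\<close>

lemma abc_without_coprimality:
  assumes abc_conjecture "\<epsilon> > 0"
  obtains C :: real where "C > 0" "\<And>a b :: nat. a > 0 \<Longrightarrow> b > 0 \<Longrightarrow>
    real (a + b) \<le> C * real a * real (radical (a * b * (a + b))) powr (1 + \<epsilon>)"
proof -
  from assms(1) [unfolded abc_conjecture_def, rule_format, OF assms(2)] obtain C where C: "C > 0" and
    abc: "\<forall>a b c :: nat. a > 0 \<and> b > 0 \<and> c > 0 \<and> Gcd {a, b, c} = 1 \<and> a + b = c \<longrightarrow>
          real c \<le> C * real (radical (a * b * c)) powr (1 + \<epsilon>)"
    unfolding radical_def [symmetric] by (elim exE conjE)
  have "real (a + b) \<le> C * real a * real (radical (a * b * (a + b))) powr (1 + \<epsilon>)"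
    if ab: "a > 0" "b > 0" for a b
  proof -
    define g where "g = gcd a b"
    obtain a' b' where a': "a = g * a'" and b': "b = g * b'" and cop: "coprime a' b'"
      using ab gcd_coprime_exists [of a b] unfolding g_def by (metis gcd_eq_0_iff less_irrefl mult.commute)
    have pos: "g > 0" "a' > 0" "b' > 0"
      using ab a' b' by (auto intro!: Nat.gr0I)
    have "Gcd {a', b', a' + b'} dvd gcd a' b'"
      by (intro gcd_greatest Gcd_dvd) auto
    then have "Gcd {a', b', a' + b'} = 1"
      using cop by simp
    then have "real (a' + b') \<le> C * real (radical (a' * b' * (a' + b'))) powr (1 + \<epsilon>)"
      using pos abc by blast
    also have "\<dots> \<le> C * real (radical (a * b * (a + b))) powr (1 + \<epsilon>)"
    proof -
      have "a' * b' * (a' + b') dvd a * b * (a + b)"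
        unfolding a' b' distrib_left [symmetric] by (intro mult_dvd_mono) auto
      then have "radical (a' * b' * (a' + b')) \<le> radical (a * b * (a + b))"
        using ab by (intro radical_mono) (auto intro: dvd_trans)
      then show ?thesis
        using C \<open>\<epsilon> > 0\<close> by (intro mult_left_mono powr_mono2) auto
    qed
    finally have "real g * real (a' + b') \<le> real g * (C * real (radical (a * b * (a + b))) powr (1 + \<epsilon>))"
      by (intro mult_left_mono) auto
    also have "\<dots> \<le> real a * (C * real (radical (a * b * (a + b))) powr (1 + \<epsilon>))"
      using C pos by (intro mult_right_mono) (auto simp: a')
    finally show ?thesis
      by (simp add: a' b' algebra_simps)
  qed
  with C show ?thesis
    by (intro that)
qed

text \<open>The rational function \<open>x\<^sup>M (1 - x)\<^sup>N\<close> is ramified at \<open>M / (M + N)\<close>, which is Belyi's way of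
  sending four rational points to three.  In the variable \<open>v\<close> below that point is moved to \<open>0\<close>, the other
  points being \<open>-\<beta>\<close>, \<open>N \<beta> / M\<close> and infinity.\<close>

lemma belyi_identity:
  fixes M N \<beta> :: nat
  assumes "M > 0" "N > 0" "even N"
  obtains R :: "int poly" where "\<And>v :: int.
    (int M * v + int M * int \<beta>) ^ M * (int M * v - int N * int \<beta>) ^ N
      = (int M * int \<beta>) ^ M * (int N * int \<beta>) ^ N + v\<^sup>2 * poly R v"
proof -
  define p where "p = [:int M * int \<beta>, int M:] ^ M * [:- (int N * int \<beta>), int M:] ^ N"
  obtain c0 c1 R where p: "p = pCons c0 (pCons c1 R)"
    by (metis pCons_cases)
  have c0: "c0 = (int M * int \<beta>) ^ M * (int N * int \<beta>) ^ N"
  proof -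
    have "c0 = poly p 0"
      by (simp add: p)
    \<comment> \<open>Evenness of \<open>N\<close> removes the sign of
      \<open>(- N \<beta>)^N\<close>, so the constant term is a natural number.\<close>
    also have "\<dots> = (int M * int \<beta>) ^ M * (int N * int \<beta>) ^ N"
      using assms by (simp add: p_def)
    finally show ?thesis .
  qed
  \<comment> \<open>The linear coefficient vanishes because \<open>0\<close> is a critical point:
    the logarithmic derivatives of the two factors there are \<open>M / \<beta>\<close> and
    \<open>- M / \<beta>\<close>.\<close>
  have "c1 = poly (pderiv p) 0"
    by (simp add: p pderiv_pCons)
  also have "\<dots> = 0"
  proof -
    have "poly (pderiv p) 0 =
        int M * int \<beta> * (int M * int \<beta>) ^ (M - 1) * (int N * int M * (- (int N * int \<beta>)) ^ (N - 1))
        - int M * int M * (int M * int \<beta>) ^ (M - 1) * (int N * int \<beta> * (- (int N * int \<beta>)) ^ (N - 1))"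
    proof -
      have "pderiv p = [:int M * int \<beta>, int M:] ^ M *
            Polynomial.smult (int N) ([:- (int N * int \<beta>), int M:] ^ (N - 1) * pderiv [:- (int N * int \<beta>), int M:])
          + [:- (int N * int \<beta>), int M:] ^ N *
            Polynomial.smult (int M) ([:int M * int \<beta>, int M:] ^ (M - 1) * pderiv [:int M * int \<beta>, int M:])"
        unfolding p_def pderiv_mult pderiv_power ..
      then have "poly (pderiv p) 0 = (int M * int \<beta>) ^ M * (int N * ((- (int N * int \<beta>)) ^ (N - 1) * int M))
          + (- (int N * int \<beta>)) ^ N * (int M * ((int M * int \<beta>) ^ (M - 1) * int M))"
        by (simp add: pderiv_pCons)
      moreover have "(int M * int \<beta>) ^ M = int M * int \<beta> * (int M * int \<beta>) ^ (M - 1)"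
        "(- (int N * int \<beta>)) ^ N = - (int N * int \<beta>) * (- (int N * int \<beta>)) ^ (N - 1)"
        using assms by (simp_all add: power_eq_if)
      ultimately show ?thesis
        by (simp only:) (simp add: algebra_simps)
    qed
    then show ?thesis
      by (simp add: mult_ac)
  qed
  finally have "c1 = 0" .
  have "(int M * v + int M * int \<beta>) ^ M * (int M * v - int N * int \<beta>) ^ N
      = (int M * int \<beta>) ^ M * (int N * int \<beta>) ^ N + v\<^sup>2 * poly R v" for v
  proof -
    have "(int M * v + int M * int \<beta>) ^ M * (int M * v - int N * int \<beta>) ^ N = poly p v"
      by (simp add: p_def algebra_simps)
    also have "\<dots> = c0 + v\<^sup>2 * poly R v"
      using \<open>c1 = 0\<close> by (simp add: p power2_eq_square algebra_simps)
    finally show ?thesis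
      by (simp add: c0)
  qed
  then show ?thesis
    by (rule that)
qed

section \<open>Large square divisors at two multiples of the same integer\<close>

text \<open>The condition \<open>q^3 > n^2\<close> says \<open>q > n^(2/3)\<close> without real
  exponents. The divisibility is over the integers because the value can be negative for small
  \<open>n\<close>.\<close>

definition large_square_divisor :: "nat \<Rightarrow> nat \<Rightarrow> nat \<Rightarrow> nat \<Rightarrow> bool" where
  "large_square_divisor \<alpha> \<beta> k n \<longleftrightarrow>
     (\<exists>q :: nat. prime q \<and> q ^ 3 > n\<^sup>2 \<and> (int q)\<^sup>2 dvd int \<alpha> * int n ^ k - int \<beta>)"

lemma le_if_square_le_cube:
  fixes n q :: nat
  assumes "n > 0" "n\<^sup>2 \<le> q ^ 3"
  shows "real n powr (2/3) \<le> real q"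
proof -
  have "q > 0"
    using assms by (auto intro!: Nat.gr0I)
  have "real (n\<^sup>2) \<le> real (q ^ 3)"
    using assms(2) by (rule of_nat_mono)
  then have "(real n ^ 2) powr (1/3) \<le> (real q ^ 3) powr (1/3)"
    by (intro powr_mono2) auto
  then show ?thesis
    using assms(1) \<open>q > 0\<close> by (simp add: powr_powr flip: powr_numeral)
qed

text \<open>Let \<open>v\<close> and \<open>w\<close> be the values at \<open>a * n\<close> and
  \<open>b * n\<close>. Then \<open>B v + B \<beta> = L n^k\<close> and
  \<open>B v - N \<beta> = A w\<close>, so Belyi's identity reads
  \<open>c = (L n^k)^B (A w)^N = a0 + v^2 t\<close>, with \<open>a0\<close> independent of
  \<open>n\<close>. The radical of the triple is at most a constant times
  \<open>n * t * radical v * radical w\<close>, and the two square divisors save a factor of at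
  least \<open>n^(4/3)\<close>, more than the factor \<open>n\<close>.\<close>

lemma large_square_divisor_radical_bound:
  fixes \<alpha> \<beta> k a b :: nat
  assumes "\<alpha> > 0" "\<beta> > 0" "k > 0" "odd a" "odd b" "b < a"
  defines "L \<equiv> a ^ k * b ^ k * \<alpha>"
  obtains a0 :: nat where "a0 > 0"
    "\<And>n. n > a0 + \<beta> \<Longrightarrow> large_square_divisor \<alpha> \<beta> k (a * n) \<Longrightarrow> large_square_divisor \<alpha> \<beta> k (b * n) \<Longrightarrow>
      \<exists>b0 > 0. a0 + b0 \<le> (L * n ^ k) ^ (a ^ k) \<and>
        real (radical (a0 * b0 * (a0 + b0))) * (real n powr (2/3))\<^sup>2
          \<le> real (a0 * (L * a ^ k)) * real n * real (a0 + b0)"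
proof -
  define A B where "A = a ^ k" and "B = b ^ k"
  define N where "N = A - B"
  have b: "b > 0"
    using assms by (auto intro!: Nat.gr0I)
  have AB: "B < A" "B > 0"
    unfolding A_def B_def using assms b by (auto intro: power_strict_mono)
  \<comment> \<open>Here the oddness of \<open>a\<close> and \<open>b\<close> enters:
    \<open>A\<close> and \<open>B\<close> are odd, so \<open>N\<close> is even, as the identity
    demands.\<close>
  have N: "N > 0" "even N" "B + N = A"
    using AB assms by (auto simp: N_def A_def B_def)
  obtain R :: "int poly" where R: "\<And>v. (int B * v + int B * int \<beta>) ^ B * (int B * v - int N * int \<beta>) ^ N
      = (int B * int \<beta>) ^ B * (int N * int \<beta>) ^ N + v\<^sup>2 * poly R v"
    using belyi_identity [of B N \<beta>] AB N by blast
  define a0 where "a0 = (B * \<beta>) ^ B * (N * \<beta>) ^ N"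
  have a0: "a0 > 0"
    using AB N assms by (simp add: a0_def)
  have "\<exists>b0 > 0. a0 + b0 \<le> (L * n ^ k) ^ (a ^ k) \<and>
        real (radical (a0 * b0 * (a0 + b0))) * (real n powr (2/3))\<^sup>2
          \<le> real (a0 * (L * a ^ k)) * real n * real (a0 + b0)"
    if n: "n > a0 + \<beta>" and ga: "large_square_divisor \<alpha> \<beta> k (a * n)" and gb: "large_square_divisor \<alpha> \<beta> k (b * n)" for n
  proof -
    have nk: "n \<le> n ^ k"
      using assms n by (intro self_le_power) auto
    have le: "n \<le> \<alpha> * B * n ^ k" "\<alpha> * B * n ^ k \<le> \<alpha> * A * n ^ k"
      using nk AB assms by (auto intro: order.trans [OF nk])
    define v where "v = \<alpha> * A * n ^ k - \<beta>"
    define w where "w = \<alpha> * B * n ^ k - \<beta>"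
    have le': "\<beta> \<le> \<alpha> * A * n ^ k" "\<beta> \<le> \<alpha> * B * n ^ k"
      using le n by linarith+
    have int_v: "int v = int \<alpha> * int (a * n) ^ k - int \<beta>"
      unfolding v_def of_nat_diff [OF le'(1)] by (simp add: A_def power_mult_distrib)
    have int_w: "int w = int \<alpha> * int (b * n) ^ k - int \<beta>"
      unfolding w_def of_nat_diff [OF le'(2)] by (simp add: B_def power_mult_distrib)
    have vw: "v > 0" "w > 0" "w \<le> v"
      using le n unfolding v_def w_def by linarith+
    define c where "c = (L * n ^ k) ^ B * (A * w) ^ N"
    have "int c = (int B * int v + int B * int \<beta>) ^ B * (int B * int v - int N * int \<beta>) ^ N"
    proof -
      have "int B * int v + int B * int \<beta> = int (L * n ^ k)"
        by (simp add: int_v L_def A_def B_def power_mult_distrib algebra_simps)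
      moreover have "int B * int v - int N * int \<beta> = int (A * w)"
      proof -
        have v': "int v = int \<alpha> * ((int B + int N) * int n ^ k) - int \<beta>"
          using N(3) by (simp add: int_v A_def power_mult_distrib flip: of_nat_add)
        have w': "int w = int \<alpha> * (int B * int n ^ k) - int \<beta>"
          by (simp add: int_w B_def power_mult_distrib)
        show ?thesis
          unfolding of_nat_mult v' w' N(3) [symmetric] of_nat_add by (simp add: algebra_simps)
      qed
      ultimately show ?thesis
        by (simp add: c_def)
    qed
    also have "\<dots> = int a0 + (int v)\<^sup>2 * poly R (int v)"
      unfolding R by (simp add: a0_def)
    finally have c: "int c = int a0 + (int v)\<^sup>2 * poly R (int v)" .
    \<comment> \<open>The chain ends in \<open>c > a0\<close>. Hence \<open>R\<close> is positive at
      \<open>v\<close>, and \<open>v^2 t\<close> is a positive natural number that can serve as the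
      second member of an abc triple.\<close>
    have "a0 < n"
      using n by simp
    also have "n \<le> L * n ^ k"
      using nk assms b by (auto simp: L_def intro: order.trans [OF nk])
    also have "\<dots> \<le> (L * n ^ k) ^ B"
      using AB n assms b by (intro self_le_power) (auto simp: L_def Suc_le_eq)
    also have "\<dots> \<le> c"
      using AB vw by (simp add: c_def)
    finally have "a0 < c" .
    then have "(int v)\<^sup>2 * poly R (int v) > 0"
      using c by simp
    then have "poly R (int v) > 0"
      using vw by (simp add: zero_less_mult_iff)
    then obtain t where t: "poly R (int v) = int t" "t > 0"
      by (metis of_nat_0_less_iff pos_int_cases)
    have c_eq: "c = a0 + v\<^sup>2 * t"
      using c t by (metis of_nat_add of_nat_eq_iff of_nat_mult of_nat_power)
    have pos: "v\<^sup>2 * t > 0"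
      using vw t by simp
    obtain q1 where q1: "prime q1" "(a * n)\<^sup>2 < q1 ^ 3" "q1\<^sup>2 dvd v"
      using ga unfolding large_square_divisor_def int_v [symmetric] by (auto simp flip: of_nat_power)
    obtain q2 where q2: "prime q2" "(b * n)\<^sup>2 < q2 ^ 3" "q2\<^sup>2 dvd w"
      using gb unfolding large_square_divisor_def int_w [symmetric] by (auto simp flip: of_nat_power)
    have q_ge: "real n powr (2/3) \<le> real q1" "real n powr (2/3) \<le> real q2"
    proof -
      have "n\<^sup>2 \<le> (a * n)\<^sup>2" "n\<^sup>2 \<le> (b * n)\<^sup>2"
        using b assms by (auto intro!: power_mono)
      then have "n\<^sup>2 \<le> q1 ^ 3" "n\<^sup>2 \<le> q2 ^ 3"
        using q1(2) q2(2) by linarith+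
      then show "real n powr (2/3) \<le> real q1" "real n powr (2/3) \<le> real q2"
        using n by (auto intro!: le_if_square_le_cube)
    qed
    have L: "L > 0"
      using assms b by (simp add: L_def)
    have "radical (a0 * (v\<^sup>2 * t) * c) \<le> radical a0 * (radical (v\<^sup>2) * radical t) * radical c"
      using a0 pos \<open>a0 < c\<close> vw t
      by (intro order.trans [OF radical_mult_le] mult_mono order.refl) auto
    also have "radical c \<le> radical (L * n) * (radical A * radical w)"
    proof -
      have "radical c \<le> radical ((L * n ^ k) ^ B) * radical ((A * w) ^ N)"
        unfolding c_def using L n AB vw by (intro radical_mult_le) auto
      also have "\<dots> \<le> radical (L * n) * radical (A * w)"
      proof (intro mult_mono)
        show "radical ((L * n ^ k) ^ B) \<le> radical (L * n)"
          using L n by (intro radical_mono) (simp, metis prime_dvd_mult_iff prime_dvd_power)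
        show "radical ((A * w) ^ N) \<le> radical (A * w)"
          using AB vw by (intro radical_power_le) auto
      qed auto
      also have "\<dots> \<le> radical (L * n) * (radical A * radical w)"
        using AB vw by (intro mult_mono radical_mult_le) auto
      finally show ?thesis .
    qed
    finally have "radical (a0 * (v\<^sup>2 * t) * c)
      \<le> radical a0 * (radical (v\<^sup>2) * radical t) * (radical (L * n) * (radical A * radical w))"
      by simp
    \<comment> \<open>Everything is estimated trivially except the radicals of \<open>v\<close> and
      \<open>w\<close>, which carry the square factors.\<close>
    also have "\<dots> \<le> a0 * (radical v * t) * (L * n * (A * radical w))"
      using a0 vw t L n AB by (intro mult_mono radical_le radical_power_le) auto
    finally have "radical (a0 * (v\<^sup>2 * t) * c) * (q1 * q2)
        \<le> (a0 * (radical v * t) * (L * n * (A * radical w))) * (q1 * q2)"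
      by (rule mult_right_mono) simp
    also have "\<dots> = a0 * (L * A) * n * t * (radical v * q1) * (radical w * q2)"
      by (simp add: mult_ac)
    \<comment> \<open>Each of \<open>q1\<close> and \<open>q2\<close> is absorbed by its radical;
      \<open>w <= v\<close> then restores the summand \<open>v^2 t\<close>, which is at most
      \<open>c\<close>.\<close>
    also have "\<dots> \<le> a0 * (L * A) * n * t * v * w"
      using vw q1 q2 by (intro mult_mono radical_times_prime_le order.refl) auto
    also have "\<dots> \<le> a0 * (L * A) * n * t * v * v"
      using vw by (intro mult_mono order.refl) auto
    also have "\<dots> = a0 * (L * A) * n * (v\<^sup>2 * t)"
      by (simp add: power2_eq_square mult_ac)
    also have "\<dots> \<le> a0 * (L * A) * n * c"
      by (intro mult_mono order.refl) (auto simp: c_eq)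
    finally have main: "radical (a0 * (v\<^sup>2 * t) * c) * (q1 * q2) \<le> a0 * (L * A) * n * c" .
    have "real (radical (a0 * (v\<^sup>2 * t) * c)) * (real n powr (2/3))\<^sup>2
        \<le> real (radical (a0 * (v\<^sup>2 * t) * c)) * (real q1 * real q2)"
      unfolding power2_eq_square using q_ge by (intro mult_left_mono mult_mono) auto
    also have "\<dots> \<le> real (a0 * (L * A) * n * c)"
      using of_nat_mono [OF main, where 'a = real] by simp
    finally have "real (radical (a0 * (v\<^sup>2 * t) * c)) * (real n powr (2/3))\<^sup>2
        \<le> real (a0 * (L * A)) * real n * real c"
      by (simp only: of_nat_mult)
    \<comment> \<open>A bound polynomial in \<open>n\<close>, so that a small power of
      \<open>c\<close> is a small power of \<open>n\<close>.\<close>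
    moreover have "c \<le> (L * n ^ k) ^ A"
    proof -
      have "A * w \<le> L * n ^ k"
        by (simp add: w_def L_def A_def B_def diff_mult_distrib2 mult_ac)
      then have "c \<le> (L * n ^ k) ^ B * (L * n ^ k) ^ N"
        unfolding c_def by (intro mult_left_mono power_mono) auto
      then show ?thesis
        by (simp add: power_add flip: N(3))
    qed
    ultimately show ?thesis
      using pos by (intro exI [of _ "v\<^sup>2 * t"]) (auto simp: c_eq A_def)
  qed
  with a0 show ?thesis
    by (rule that)
qed

text \<open>The radical of the triple is at most a constant times \<open>c n^(-1/3)\<close>. The abc
  conjecture then gives \<open>n^((1+\<epsilon>)/3) <= const * c^\<epsilon>\<close>, which fails for
  large \<open>n\<close> because \<open>c\<close> is polynomially bounded.\<close>

lemma abc_imp_not_both_large_square_divisor: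
  fixes \<alpha> \<beta> k a b :: nat
  assumes abc: abc_conjecture
    and pos: "\<alpha> > 0" "\<beta> > 0" "k > 0" and ab: "odd a" "odd b" "b < a"
  shows "eventually (\<lambda>n. \<not> (large_square_divisor \<alpha> \<beta> k (a * n) \<and> large_square_divisor \<alpha> \<beta> k (b * n))) sequentially"
proof -
  define L where "L = a ^ k * b ^ k * \<alpha>"
  define D where "D = a ^ k"
  have D: "D > 0" "L > 0"
    using ab pos by (auto simp: D_def L_def intro!: Nat.gr0I)
  \<comment> \<open>Chosen so that \<open>c <= (L n^k)^D\<close> makes \<open>c^\<epsilon>\<close>
    at most a constant times \<open>n^(1/6)\<close>, below the saving
    \<open>n^(1/3)\<close>.\<close>
  define \<epsilon> :: real where "\<epsilon> = 1 / (6 * real k * real D)"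
  have \<epsilon>: "\<epsilon> > 0"
    using D pos by (simp add: \<epsilon>_def)
  obtain a0 :: nat where a0: "a0 > 0" and
    rad: "\<And>n. n > a0 + \<beta> \<Longrightarrow> large_square_divisor \<alpha> \<beta> k (a * n) \<Longrightarrow> large_square_divisor \<alpha> \<beta> k (b * n) \<Longrightarrow>
      \<exists>b0 > 0. a0 + b0 \<le> (L * n ^ k) ^ D \<and>
        real (radical (a0 * b0 * (a0 + b0))) * (real n powr (2/3))\<^sup>2
          \<le> real (a0 * (L * D)) * real n * real (a0 + b0)"
    using large_square_divisor_radical_bound [OF pos ab] unfolding L_def D_def by blast
  obtain C :: real where C: "C > 0" and abc: "\<And>a b :: nat. a > 0 \<Longrightarrow> b > 0 \<Longrightarrow>
    real (a + b) \<le> C * real a * real (radical (a * b * (a + b))) powr (1 + \<epsilon>)"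
    using abc_without_coprimality [OF abc \<epsilon>] by blast
  define K where "K = real (a0 * (L * D))"
  have K: "K > 0"
    using a0 D by (simp add: K_def)
  define K' where "K' = C * real a0 * K powr (1 + \<epsilon>) * (real L powr (real D * \<epsilon>))"
  have "eventually (\<lambda>n. K' * real n powr (1/6) < real n powr (1/3)) sequentially"
    by real_asymp
  then show ?thesis
    using eventually_gt_at_top [of "a0 + \<beta>"]
  proof eventually_elim
    case (elim n)
    have n: "n > 0"
      using elim by simp
    show ?case
    proof
      assume "large_square_divisor \<alpha> \<beta> k (a * n) \<and> large_square_divisor \<alpha> \<beta> k (b * n)"
      then obtain b0 where b0: "b0 > 0" "a0 + b0 \<le> (L * n ^ k) ^ D" and
        r: "real (radical (a0 * b0 * (a0 + b0))) * (real n powr (2/3))\<^sup>2 \<le> K * real n * real (a0 + b0)"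
        using rad [OF elim(2)] unfolding K_def by blast
      define c where "c = real (a0 + b0)"
      have c: "c > 0"
        using a0 by (simp add: c_def)
      have "real (radical (a0 * b0 * (a0 + b0))) \<le> K * real n * c / (real n powr (2/3))\<^sup>2"
        using r n by (simp add: c_def field_simps)
      also have "\<dots> = K * c * real n powr (- 1/3)"
      proof -
        have "real n = real n powr 1"
          using n by simp
        also have "\<dots> = real n powr (- 1/3) * (real n powr (2/3))\<^sup>2"
          unfolding power2_eq_square powr_add [symmetric] by simp
        finally have eq: "real n = real n powr (- 1/3) * (real n powr (2/3))\<^sup>2" .
        show ?thesis
          by (subst eq) (use n in simp)
      qed
      finally have rad_le: "real (radical (a0 * b0 * (a0 + b0))) \<le> K * c * real n powr (- 1/3)" .
      have "c \<le> C * real a0 * real (radical (a0 * b0 * (a0 + b0))) powr (1 + \<epsilon>)"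
        unfolding c_def using a0 b0 by (intro abc)
      also have "\<dots> \<le> C * real a0 * (K * c * real n powr (- 1/3)) powr (1 + \<epsilon>)"
        using C rad_le \<epsilon> by (intro mult_left_mono powr_mono2) auto
      also have "\<dots> = c * (C * real a0 * K powr (1 + \<epsilon>) * c powr \<epsilon> * real n powr (- (1 + \<epsilon>) / 3))"
      proof -
        have "(K * c * real n powr (- 1/3)) powr (1 + \<epsilon>) = K powr (1 + \<epsilon>) * c powr (1 + \<epsilon>) * (real n powr (- 1/3)) powr (1 + \<epsilon>)"
          using K c by (simp add: powr_mult)
        also have "c powr (1 + \<epsilon>) = c * c powr \<epsilon>"
          using c by (simp add: powr_add)
        also have "(real n powr (- 1/3)) powr (1 + \<epsilon>) = real n powr (- (1 + \<epsilon>) / 3)"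
          unfolding powr_powr by (intro arg_cong2 [where f = "(powr)"] refl) (simp add: field_simps)
        finally show ?thesis
          by (simp only: mult_ac)
      qed
      finally have "1 \<le> C * real a0 * K powr (1 + \<epsilon>) * c powr \<epsilon> * real n powr (- (1 + \<epsilon>) / 3)"
        using c by simp
      then have "1 * real n powr ((1 + \<epsilon>) / 3) \<le>
          C * real a0 * K powr (1 + \<epsilon>) * c powr \<epsilon> * real n powr (- (1 + \<epsilon>) / 3) * real n powr ((1 + \<epsilon>) / 3)"
        by (intro mult_right_mono) auto
      also have "\<dots> = C * real a0 * K powr (1 + \<epsilon>) * c powr \<epsilon>"
      proof -
        have "- (1 + \<epsilon>) / 3 + (1 + \<epsilon>) / 3 = 0"
          by (simp add: field_simps)
        then have "real n powr (- (1 + \<epsilon>) / 3) * real n powr ((1 + \<epsilon>) / 3) = 1"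
          using n by (simp flip: powr_add)
        then show ?thesis
          by (simp add: mult.assoc)
      qed
      also have "\<dots> \<le> C * real a0 * K powr (1 + \<epsilon>) * (real L powr (real D * \<epsilon>) * real n powr (1 / 6))"
      proof (intro mult_left_mono)
        have "c \<le> (real L * real n ^ k) ^ D"
          unfolding c_def using of_nat_mono [OF b0(2), where 'a = real] by simp
        then have "c powr \<epsilon> \<le> ((real L * real n ^ k) ^ D) powr \<epsilon>"
          using c \<epsilon> by (intro powr_mono2) auto
        also have "\<dots> = real L powr (real D * \<epsilon>) * real n powr (real k * real D * \<epsilon>)"
          using n D by (simp add: powr_mult powr_powr power_mult_distrib flip: powr_realpow)
        also have "real k * real D * \<epsilon> = 1 / 6"
          using D pos by (simp add: \<epsilon>_def)
        finally show "c powr \<epsilon> \<le> real L powr (real D * \<epsilon>) * real n powr (1 / 6)" .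
      qed (use C K in auto)
      also have "\<dots> = K' * real n powr (1 / 6)"
        by (simp add: K'_def)
      also have "\<dots> < real n powr (1 / 3)"
        by (rule elim)
      finally have "real n powr ((1 + \<epsilon>) / 3) < real n powr (1 / 3)"
        by simp
      moreover have "real n powr (1 / 3) \<le> real n powr ((1 + \<epsilon>) / 3)"
        using n \<epsilon> by (intro powr_mono) auto
      ultimately show False
        by simp
    qed
  qed
qed

subsection \<open>Roots of binomials modulo squares of primes\<close>

text \<open>Dividing by \<open>w^2\<close> shows that \<open>3\<close> is a quadratic residue. By
  reciprocity \<open>p\<close> is then a square modulo \<open>3\<close> exactly when
  \<open>(p - 1) / 2\<close> is even, so \<open>p\<close> is \<open>1\<close> modulo
  \<open>3\<close> exactly when it is \<open>1\<close> modulo \<open>4\<close>.\<close>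

lemma mod_12_if_3_square:
  fixes p :: nat and u w :: int
  assumes p: "prime p" "p > 3" and sq: "[u\<^sup>2 = 3 * w\<^sup>2] (mod int p)" and w: "\<not> int p dvd w"
  shows "p mod 12 = 1 \<or> p mod 12 = 11"
proof -
  have "coprime w (int p)"
    using p w by (metis coprime_commute prime_imp_coprime prime_nat_int_transfer)
  then obtain w' where w': "[w * w' = 1] (mod int p)"
    using cong_solve_coprime_int by blast
  have "[(u * w')\<^sup>2 = 3 * (w * w')\<^sup>2] (mod int p)"
    using cong_scalar_right [OF sq, of "w'\<^sup>2"] by (simp add: power_mult_distrib mult.assoc)
  also have "[3 * (w * w')\<^sup>2 = 3 * 1\<^sup>2] (mod int p)"
    using w' by (intro cong_scalar_left cong_pow)
  finally have "QuadRes (int p) 3"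
    by (auto simp: QuadRes_def)
  moreover have "\<not> [3 = 0] (mod int p)"
    using p by (auto simp: cong_0_iff dest: zdvd_imp_le)
  ultimately have L1: "Legendre 3 (int p) = 1"
    by (simp add: Legendre_def)
  have odd: "odd p" and not3: "\<not> 3 dvd p"
    using p prime_odd_nat [of p] primes_dvd_imp_eq [of 3 p] by auto
  have "Legendre (int p) (int 3) * Legendre (int 3) (int p) = (-1) ^ ((p - 1) div 2 * ((3 - 1) div 2))"
    using p by (intro Quadratic_Reciprocity) auto
  then have L2: "Legendre (int p) 3 = (-1) ^ ((p - 1) div 2)"
    using L1 by simp
  have "Legendre (int p) 3 = 1 \<longleftrightarrow> p mod 3 = 1"
  proof -
    have not0: "\<not> [int p = 0] (mod 3)"
      using not3 by (simp add: cong_0_iff) presburger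
    have "QuadRes 3 (int p) \<longleftrightarrow> p mod 3 = 1"
    proof
      assume "QuadRes 3 (int p)"
      then obtain y where y: "y\<^sup>2 mod 3 = int p mod 3"
        unfolding QuadRes_def unique_euclidean_semiring_class.cong_def by blast
      have "y\<^sup>2 mod 3 = (y mod 3)\<^sup>2 mod 3"
        by (simp add: power_mod)
      moreover have "y mod 3 = 0 \<or> y mod 3 = 1 \<or> y mod 3 = 2"
        by presburger
      ultimately have "int p mod 3 = 0 \<or> int p mod 3 = 1"
        using y by auto
      then show "p mod 3 = 1"
        using not3 by presburger
    next
      assume "p mod 3 = 1"
      then have "[1\<^sup>2 = int p] (mod 3)"
        by (simp add: unique_euclidean_semiring_class.cong_def) presburger
      then show "QuadRes 3 (int p)"
        unfolding QuadRes_def by blast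
    qed
    then show ?thesis
      using not0 by (simp add: Legendre_def)
  qed
  then have "p mod 3 = 1 \<longleftrightarrow> even ((p - 1) div 2)"
    by (auto simp: L2 minus_one_power_iff split: if_split_asm)
  moreover have "even ((p - 1) div 2) \<longleftrightarrow> p mod 4 = 1"
    using odd by presburger
  ultimately have "p mod 4 = 1 \<and> p mod 3 = 1 \<or> p mod 4 = 3 \<and> p mod 3 = 2"
    using odd not3 by presburger
  then have "(p mod 12) mod 4 = 1 \<and> (p mod 12) mod 3 = 1 \<or> (p mod 12) mod 4 = 3 \<and> (p mod 12) mod 3 = 2"
    by (simp add: mod_mod_cancel)
  moreover have "r < 12 \<Longrightarrow> r \<in> {0, 1, 2, 3, 4, 5, 6, 7, 8, 9, 10, 11}" for r :: nat
    by (auto simp: eval_nat_numeral less_Suc_eq)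
  then have "p mod 12 \<in> {0, 1, 2, 3, 4, 5, 6, 7, 8, 9, 10, 11}"
    by simp
  ultimately show ?thesis
    by auto
qed

section \<open>Counting roots modulo \<open>p\<close> and modulo its square\<close>

definition square_divisor_set :: "nat \<Rightarrow> nat \<Rightarrow> nat \<Rightarrow> nat \<Rightarrow> nat set" where
  "square_divisor_set \<alpha> \<beta> k p = {n. (int p)\<^sup>2 dvd int \<alpha> * int n ^ k - int \<beta>}"

lemma in_square_divisor_set_iff_cong:
  "n \<in> square_divisor_set \<alpha> \<beta> k p \<longleftrightarrow> [\<alpha> * n ^ k = \<beta>] (mod p\<^sup>2)"
proof -
  have "n \<in> square_divisor_set \<alpha> \<beta> k p \<longleftrightarrow> [int (\<alpha> * n ^ k) = int \<beta>] (mod int (p\<^sup>2))"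
    by (simp add: square_divisor_set_def cong_iff_dvd_diff)
  then show ?thesis
    by (simp only: cong_int_iff)
qed

text \<open>Hensel's lemma, in the form that a simple root modulo \<open>p\<close> has at most one lift modulo \<open>p\<^sup>2\<close>.\<close>

lemma card_square_divisor_set_le_roots:
  assumes p: "prime p" and ndvd: "\<not> p dvd \<alpha>" "\<not> p dvd \<beta>" "\<not> p dvd k"
  shows "card (square_divisor_set \<alpha> \<beta> k p \<inter> {..<p\<^sup>2}) \<le> card {x \<in> {..<p}. [\<alpha> * x ^ k = \<beta>] (mod p)}"
proof (rule card_inj_on_le [of "\<lambda>n. n mod p"])
  have dvd: "p dvd p\<^sup>2"
    by (simp add: power2_eq_square)
  show "(\<lambda>n. n mod p) ` (square_divisor_set \<alpha> \<beta> k p \<inter> {..<p\<^sup>2}) \<subseteq> {x \<in> {..<p}. [\<alpha> * x ^ k = \<beta>] (mod p)}"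
  proof (rule image_subsetI)
    fix n assume "n \<in> square_divisor_set \<alpha> \<beta> k p \<inter> {..<p\<^sup>2}"
    then have "n \<in> square_divisor_set \<alpha> \<beta> k p"
      by simp
    then have "[\<alpha> * n ^ k = \<beta>] (mod p)"
      using dvd unfolding in_square_divisor_set_iff_cong by (rule cong_dvd_modulus_nat)
    moreover have "[\<alpha> * (n mod p) ^ k = \<alpha> * n ^ k] (mod p)"
      by (intro cong_scalar_left cong_pow) simp
    ultimately have "[\<alpha> * (n mod p) ^ k = \<beta>] (mod p)"
      by (rule cong_trans [rotated])
    then show "n mod p \<in> {x \<in> {..<p}. [\<alpha> * x ^ k = \<beta>] (mod p)}"
      using p by (simp add: prime_gt_0_nat)
  qed
  show "inj_on (\<lambda>n. n mod p) (square_divisor_set \<alpha> \<beta> k p \<inter> {..<p\<^sup>2})"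
  proof (rule inj_onI)
    fix m n assume m: "m \<in> square_divisor_set \<alpha> \<beta> k p \<inter> {..<p\<^sup>2}"
      and n: "n \<in> square_divisor_set \<alpha> \<beta> k p \<inter> {..<p\<^sup>2}" and eq: "m mod p = n mod p"
    have ip: "prime (int p)"
      using p by simp
    \<comment> \<open>This is the divided difference of \<open>x^k\<close>. For \<open>m\<close> and
      \<open>n\<close> congruent modulo \<open>p\<close> it is congruent to the derivative
      \<open>k n^(k-1)\<close>, a unit modulo \<open>p\<close>, so all of \<open>p^2\<close> must
      divide \<open>m - n\<close>.\<close>
    define S where "S = (\<Sum>i<k. int m ^ i * int n ^ (k - Suc i))"
    have diff: "int m ^ k - int n ^ k = (int m - int n) * S"
      unfolding S_def by (simp add: power_diff_sumr2 mult.commute)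
    have "(int p)\<^sup>2 dvd (int \<alpha> * int m ^ k - int \<beta>) - (int \<alpha> * int n ^ k - int \<beta>)"
      using dvd_diff [of "(int p)\<^sup>2"] m n unfolding square_divisor_set_def by blast
    also have "\<dots> = int \<alpha> * (int m ^ k - int n ^ k)"
      by (simp add: algebra_simps)
    also have "\<dots> = int \<alpha> * (int m - int n) * S"
      by (simp add: diff)
    finally have dvd2: "(int p)\<^sup>2 dvd (int m - int n) * (int \<alpha> * S)"
      by (simp add: mult_ac)
    have "[int m = int n] (mod int p)"
      using eq by (simp add: unique_euclidean_semiring_class.cong_def flip: of_nat_mod)
    then have "[S = (\<Sum>i<k. int n ^ i * int n ^ (k - Suc i))] (mod int p)"
      unfolding S_def by (intro cong_sum cong_mult cong_pow cong_refl)
    also have "(\<Sum>i<k. int n ^ i * int n ^ (k - Suc i)) = (\<Sum>i<k. int n ^ (k - 1))"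
      by (intro sum.cong refl) (simp flip: power_add)
    also have "\<dots> = int k * int n ^ (k - 1)"
      by simp
    finally have S: "[S = int k * int n ^ (k - 1)] (mod int p)" .
    have "\<not> p dvd n"
    proof
      assume "p dvd n"
      then have "p dvd \<alpha> * n ^ k"
        using ndvd(3) by (cases k) auto
      moreover have "[\<alpha> * n ^ k = \<beta>] (mod p)"
        using n dvd unfolding Int_iff in_square_divisor_set_iff_cong by (blast intro: cong_dvd_modulus_nat)
      ultimately show False
        using ndvd(2) cong_dvd_iff by blast
    qed
    then have "\<not> int p dvd int k * int n ^ (k - 1)"
      using ndvd(3) ip prime_dvd_power [OF ip, of "int n" "k - 1"] by (simp add: prime_dvd_mult_iff) blast
    then have "\<not> int p dvd S"
      using S cong_dvd_iff by blast
    then have "coprime ((int p)\<^sup>2) (int \<alpha> * S)"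
      using ndvd(1) ip prime_imp_coprime [OF ip, of "int \<alpha> * S"] by (simp add: prime_dvd_mult_iff)
    then have "(int p)\<^sup>2 dvd int m - int n"
      using dvd2 by (simp add: coprime_dvd_mult_left_iff)
    then have "[int m = int n] (mod int (p\<^sup>2))"
      by (simp add: cong_iff_dvd_diff)
    then have "[m = n] (mod p\<^sup>2)"
      by (simp only: cong_int_iff)
    then show "m = n"
      using m n by (simp add: cong_less_modulus_unique_nat)
  qed
qed simp

lemma card_binomial_roots_le:
  fixes p \<alpha> \<beta> k :: nat
  assumes p: "prime p" and "\<not> p dvd \<alpha>" "k > 0"
  shows "card {x \<in> {..<p}. [\<alpha> * x ^ k = \<beta>] (mod p)} \<le> k"
proof -
  have "coprime \<alpha> p"
    using prime_imp_coprime [OF p assms(2)] by (simp add: coprime_commute)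
  then obtain \<alpha>' where \<alpha>': "[\<alpha> * \<alpha>' = 1] (mod p)"
    using cong_solve_coprime_nat by auto
  have "[x ^ k = \<alpha>' * \<beta>] (mod p)" if "[\<alpha> * x ^ k = \<beta>] (mod p)" for x
  proof -
    have "[\<alpha> * \<alpha>' * x ^ k = 1 * x ^ k] (mod p)"
      by (intro cong_scalar_right \<alpha>')
    moreover have "[\<alpha>' * (\<alpha> * x ^ k) = \<alpha>' * \<beta>] (mod p)"
      by (intro cong_scalar_left that)
    ultimately show ?thesis
      by (simp add: mult_ac) (metis cong_sym cong_trans)
  qed
  then have "card {x \<in> {..<p}. [\<alpha> * x ^ k = \<beta>] (mod p)} \<le> card {x \<in> {..<p}. [x ^ k = \<alpha>' * \<beta>] (mod p)}"
    by (intro card_mono) auto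
  also have "\<dots> \<le> k"
    using p \<open>k > 0\<close> by (rule roots_mod_prime_bound)
  finally show ?thesis .
qed

text \<open>Raising to the power \<open>e\<close> turns \<open>x^k\<close> into
  \<open>x^(p-1)\<close>, which is \<open>1\<close> modulo \<open>p\<close>. The result is the
  solvability test built into \<open>root_bound\<close>.\<close>

lemma fermat_power_cong:
  fixes p \<alpha> \<beta> k e x :: nat
  assumes "prime p" "k * e = p - 1" "\<not> p dvd \<beta>" "k > 0" "[\<alpha> * x ^ k = \<beta>] (mod p)"
  shows "[\<alpha> ^ e = \<beta> ^ e] (mod p)"
proof -
  have "\<not> p dvd x"
  proof
    assume "p dvd x"
    then have "p dvd \<alpha> * x ^ k"
      using \<open>k > 0\<close> by (cases k) auto
    then show False
      using assms cong_dvd_iff by blast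
  qed
  then have "[\<alpha> ^ e * x ^ (p - 1) = \<alpha> ^ e * 1] (mod p)"
    using assms(1) by (intro cong_scalar_left fermat_theorem)
  moreover have "\<alpha> ^ e * x ^ (p - 1) = (\<alpha> * x ^ k) ^ e"
    unfolding assms(2) [symmetric] power_mult_distrib power_mult ..
  moreover have "[(\<alpha> * x ^ k) ^ e = \<beta> ^ e] (mod p)"
    using assms(5) by (rule cong_pow)
  ultimately show ?thesis
    by (metis cong_sym cong_trans mult.right_neutral)
qed

text \<open>If \<open>k e = p + 1\<close> then \<open>x\<^sup>k\<close> determines \<open>x\<^sup>k\<^sup>e = x\<^sup>2\<close> modulo \<open>p\<close>.\<close>

lemma card_binomial_roots_le_2:
  fixes p \<alpha> \<beta> k e :: nat
  assumes p: "prime p" and "\<not> p dvd \<alpha>" "k * e = p + 1"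
  shows "card {x \<in> {..<p}. [\<alpha> * x ^ k = \<beta>] (mod p)} \<le> 2"
proof -
  have "[\<alpha> ^ e * x\<^sup>2 = \<beta> ^ e] (mod p)" if "[\<alpha> * x ^ k = \<beta>] (mod p)" for x
  proof -
    have "[x ^ (p + 1) = x\<^sup>2] (mod p)"
    proof (cases "p dvd x")
      case True
      then have "p dvd x ^ (p + 1)" "p dvd x\<^sup>2"
        by (simp_all add: power2_eq_square)
      then show ?thesis
        by (metis cong_0_iff cong_sym cong_trans)
    next
      case False
      have "p + 1 = (p - 1) + 2"
        using p prime_gt_0_nat [of p] by simp
      then have "x ^ (p + 1) = x ^ (p - 1) * x\<^sup>2"
        by (metis power_add)
      moreover have "[x ^ (p - 1) * x\<^sup>2 = 1 * x\<^sup>2] (mod p)"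
        by (intro cong_scalar_right fermat_theorem p False)
      ultimately show ?thesis
        by simp
    qed
    then have "[\<alpha> ^ e * x ^ (p + 1) = \<alpha> ^ e * x\<^sup>2] (mod p)"
      by (rule cong_scalar_left)
    moreover have "\<alpha> ^ e * x ^ (p + 1) = (\<alpha> * x ^ k) ^ e"
      unfolding assms(3) [symmetric] power_mult_distrib power_mult ..
    moreover have "[(\<alpha> * x ^ k) ^ e = \<beta> ^ e] (mod p)"
      using that by (rule cong_pow)
    ultimately show ?thesis
      by (metis cong_sym cong_trans)
  qed
  then have "card {x \<in> {..<p}. [\<alpha> * x ^ k = \<beta>] (mod p)} \<le> card {x \<in> {..<p}. [\<alpha> ^ e * x\<^sup>2 = \<beta> ^ e] (mod p)}"
    by (intro card_mono) auto
  also have "\<dots> \<le> 2"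
    using assms by (intro card_binomial_roots_le) (auto dest: prime_dvd_power)
  finally show ?thesis .
qed

text \<open>An upper bound for the number of solutions of \<open>\<alpha> x\<^sup>k = \<beta>\<close> modulo \<open>p\<close> for the two equations of
  interest: a solution makes \<open>3\<close> a square modulo \<open>p\<close>, so \<open>p\<close> is \<open>1\<close> or \<open>11\<close> modulo \<open>12\<close>, and in the
  first case \<open>\<alpha> / \<beta>\<close> must be a \<open>k\<close>-th power residue.\<close>

definition root_bound :: "nat \<Rightarrow> nat \<Rightarrow> nat \<Rightarrow> nat \<Rightarrow> nat" where
  "root_bound \<alpha> \<beta> k p =
    (if p mod 12 = 11 then 2
     else if p mod 12 = 1 \<and> \<alpha> ^ ((p - 1) div k) mod p = \<beta> ^ ((p - 1) div k) mod p then k else 0)"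

text \<open>Since \<open>k\<close> divides \<open>12\<close>, it divides \<open>p - 1\<close> in one
  residue class and \<open>p + 1\<close> in the other. Fermat's test applies in the first, the bound
  by two roots in the second, and elsewhere there are no roots.\<close>

lemma card_square_divisor_set_le_root_bound:
  assumes p: "prime p" and ndvd: "\<not> p dvd \<alpha>" "\<not> p dvd \<beta>" "\<not> p dvd k" and k: "k dvd 12"
    and p12: "\<And>x. [\<alpha> * x ^ k = \<beta>] (mod p) \<Longrightarrow> p mod 12 = 1 \<or> p mod 12 = 11"
  shows "card (square_divisor_set \<alpha> \<beta> k p \<inter> {..<p\<^sup>2}) \<le> root_bound \<alpha> \<beta> k p"
proof -
  have "k > 0"
    using k by (auto intro!: Nat.gr0I)
  let ?R = "{x \<in> {..<p}. [\<alpha> * x ^ k = \<beta>] (mod p)}"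
  have "card ?R \<le> root_bound \<alpha> \<beta> k p"
  proof (cases "?R = {}")
    case False
    then obtain x where x: "[\<alpha> * x ^ k = \<beta>] (mod p)"
      by auto
    from p12 [OF x] show ?thesis
    proof
      assume p1: "p mod 12 = 1"
      then have "12 dvd p - 1"
        by (metis dvd_minus_mod)
      then have "k * ((p - 1) div k) = p - 1"
        using k by (meson dvd_mult_div_cancel dvd_trans)
      then have "[\<alpha> ^ ((p - 1) div k) = \<beta> ^ ((p - 1) div k)] (mod p)"
        using p ndvd \<open>k > 0\<close> x by (intro fermat_power_cong)
      then have "root_bound \<alpha> \<beta> k p = k"
        using p1 by (simp add: root_bound_def unique_euclidean_semiring_class.cong_def)
      then show ?thesis
        using card_binomial_roots_le [OF p ndvd(1) \<open>k > 0\<close>] by simp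
    next
      assume p11: "p mod 12 = 11"
      then have "12 dvd p + 1"
        by presburger
      then have "k * ((p + 1) div k) = p + 1"
        using k by (meson dvd_mult_div_cancel dvd_trans)
      then show ?thesis
        using card_binomial_roots_le_2 [OF p ndvd(1)] p11 by (simp add: root_bound_def)
    qed
  next
    case True
    then show ?thesis
      by (simp only: card.empty)
  qed
  then show ?thesis
    using card_square_divisor_set_le_roots [OF p ndvd] by (rule order.trans [rotated])
qed

subsection \<open>The two densities\<close>

text \<open>Within a residue class \<open>p div 12\<close> determines \<open>p\<close>, and
  \<open>12 * (p div 12) <= p\<close>; this reduces the sum to \<open>1 / 144\<close> of a
  telescoping one over \<open>j > c\<close>.\<close>

lemma sum_inverse_squares_progression_le:
  fixes a c z :: nat
  assumes "c > 0"
  shows "(\<Sum>p\<in>{p. 12 * (c + 1) \<le> p \<and> p \<le> z \<and> p mod 12 = a}. 1 / (real p)\<^sup>2) \<le> 1 / (144 * real c)"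
proof -
  let ?T = "{p. 12 * (c + 1) \<le> p \<and> p \<le> z \<and> p mod 12 = a}"
  have "(\<Sum>p\<in>?T. 1 / (real p)\<^sup>2) \<le> (\<Sum>p\<in>?T. 1 / 144 * (1 / (real (p div 12))\<^sup>2))"
  proof (intro sum_mono)
    fix p assume "p \<in> ?T"
    then have "p div 12 > 0"
      by (simp add: div_greater_zero_iff)
    have "real (12 * (p div 12)) \<le> real p"
      by (rule of_nat_mono) simp
    then have "(real (12 * (p div 12)))\<^sup>2 \<le> (real p)\<^sup>2"
      by (intro power_mono) auto
    then have "1 / (real p)\<^sup>2 \<le> 1 / (real (12 * (p div 12)))\<^sup>2"
      using \<open>p div 12 > 0\<close> by (intro divide_left_mono mult_pos_pos) auto
    then show "1 / (real p)\<^sup>2 \<le> 1 / 144 * (1 / (real (p div 12))\<^sup>2)"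
      by (simp add: power_mult_distrib)
  qed
  also have "\<dots> = 1 / 144 * (\<Sum>p\<in>?T. 1 / (real (p div 12))\<^sup>2)"
    by (rule sum_distrib_left [symmetric])
  also have "(\<Sum>p\<in>?T. 1 / (real (p div 12))\<^sup>2) = (\<Sum>j\<in>(\<lambda>p. p div 12) ` ?T. 1 / (real j)\<^sup>2)"
    by (rule sum.reindex_cong [symmetric, OF _ refl refl])
      (auto simp: inj_on_def, metis div_mult_mod_eq)
  also have "\<dots> \<le> (\<Sum>j\<in>{c<..c + z}. 1 / (real j)\<^sup>2)"
  proof (rule sum_mono2)
    show "(\<lambda>p. p div 12) ` ?T \<subseteq> {c<..c + z}"
    proof (rule image_subsetI)
      fix p assume p: "p \<in> ?T"
      then have "(12 * (c + 1)) div 12 \<le> p div 12"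
        by (intro div_le_mono) auto
      moreover have "p div 12 \<le> z"
        using p div_le_dividend [of p 12] by (auto intro: order.trans)
      ultimately show "p div 12 \<in> {c<..c + z}"
        using p by simp
    qed
  qed auto
  also have "\<dots> \<le> 1 / real c - 1 / real (c + z)"
    using assms by (intro sum_inverse_squares_le) auto
  also have "\<dots> \<le> 1 / real c"
    by simp
  finally show ?thesis
    by simp
qed

text \<open>The primes below 204 that are 1 or 11 modulo 12.\<close>

definition small_primes :: "nat set" where
  "small_primes = {11, 13, 23, 37, 47, 59, 61, 71, 73, 83, 97, 107, 109, 131, 157, 167, 179, 181, 191, 193}"

lemma in_small_primes:
  assumes "prime p" "p > 3" "p < 204" "p mod 12 = 1 \<or> p mod 12 = 11"
  shows "p \<in> small_primes"
proof -
  define j where "j = p div 12"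
  have "p = 12 * j + p mod 12"
    by (simp add: j_def)
  then have p: "p = 12 * j + 1 \<or> p = 12 * j + 11"
    using assms(4) by presburger
  have "j < 17"
    using assms(3) by (simp add: j_def)
  then have "j \<in> {0, 1, 2, 3, 4, 5, 6, 7, 8, 9, 10, 11, 12, 13, 14, 15, 16}"
    by (auto simp: eval_nat_numeral less_Suc_eq)
  \<comment> \<open>The second list holds the remaining candidates below 204: \<open>1\<close>, and
    composites divisible by \<open>5\<close>, \<open>7\<close>, \<open>11\<close> or
    \<open>13\<close>.\<close>
  with p have "p \<in> small_primes \<or> p \<in> {1, 25, 35, 49, 85, 95, 119, 121, 133, 143, 145, 155, 169, 203}"
    by (elim insertE emptyE disjE) (simp_all add: small_primes_def)
  moreover have dvd: "q = 1 \<or> q = p" if "q dvd p" for q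
    using that assms(1) prime_nat_iff by blast
  ultimately show ?thesis
    using dvd [of 5] dvd [of 7] dvd [of 11] dvd [of 13] assms(2) by auto
qed

lemma sum_small_primes:
  fixes g :: "nat \<Rightarrow> real"
  shows "(\<Sum>p\<in>small_primes. g p) =
      g 11 + g 13 + g 23 + g 37 + g 47 + g 59 + g 61 + g 71 +
      g 73 + g 83 + g 97 + g 107 + g 109 + g 131 +
      g 157 + g 167 + g 179 + g 181 + g 191 + g 193"
  by (simp add: small_primes_def)

lemma sum_root_bound_le:
  assumes "k > 0"
  shows "(\<Sum>p\<in>{p\<in>{p. prime p \<and> p > 3}. p \<le> z}. real (root_bound \<alpha> \<beta> k p) / (real p)\<^sup>2)
    \<le> (\<Sum>p\<in>small_primes. real (root_bound \<alpha> \<beta> k p) / (real p)\<^sup>2) + (real k + 2) / 2304"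
proof -
  let ?f = "\<lambda>p. real (root_bound \<alpha> \<beta> k p) / (real p)\<^sup>2"
  let ?F = "{p\<in>{p. prime p \<and> p > 3}. p \<le> z}"
  let ?T = "\<lambda>a. {p. 12 * (16 + 1) \<le> p \<and> p \<le> z \<and> p mod 12 = a}"
  have finT: "finite (?T a)" for a
    by (rule finite_subset [of _ "{..z}"]) auto
  have "sum ?f ?F = sum ?f {p\<in>?F. p mod 12 = 1 \<or> p mod 12 = 11}"
    by (rule sum.mono_neutral_right) (auto simp: root_bound_def)
  also have "\<dots> \<le> sum ?f (small_primes \<union> (?T 1 \<union> ?T 11))"
  proof (rule sum_mono2)
    show "{p\<in>?F. p mod 12 = 1 \<or> p mod 12 = 11} \<subseteq> small_primes \<union> (?T 1 \<union> ?T 11)"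
    proof
      fix p assume "p \<in> {p\<in>?F. p mod 12 = 1 \<or> p mod 12 = 11}"
      then show "p \<in> small_primes \<union> (?T 1 \<union> ?T 11)"
        using in_small_primes [of p] by (cases "p < 204") auto
    qed
    show "finite (small_primes \<union> (?T 1 \<union> ?T 11))"
      using finT by (simp add: small_primes_def)
  qed simp
  also have "\<dots> \<le> sum ?f small_primes + sum ?f (?T 1 \<union> ?T 11)"
  proof -
    have "sum ?f (small_primes \<inter> (?T 1 \<union> ?T 11)) \<ge> 0"
      by (intro sum_nonneg) simp
    moreover have "sum ?f (small_primes \<union> (?T 1 \<union> ?T 11)) + sum ?f (small_primes \<inter> (?T 1 \<union> ?T 11))
        = sum ?f small_primes + sum ?f (?T 1 \<union> ?T 11)"
      by (intro sum.union_inter finite_UnI finT) (simp add: small_primes_def)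
    ultimately show ?thesis
      by linarith
  qed
  also have "sum ?f (?T 1 \<union> ?T 11) = sum ?f (?T 1) + sum ?f (?T 11)"
    using finT by (intro sum.union_disjoint) auto
  also have "sum ?f (?T 1) \<le> (\<Sum>p\<in>?T 1. real k * (1 / (real p)\<^sup>2))"
    by (intro sum_mono) (auto simp: root_bound_def divide_right_mono)
  also have "\<dots> = real k * (\<Sum>p\<in>?T 1. 1 / (real p)\<^sup>2)"
    by (rule sum_distrib_left [symmetric])
  also have "\<dots> \<le> real k * (1 / (144 * real 16))"
    by (intro mult_left_mono sum_inverse_squares_progression_le) auto
  also have "sum ?f (?T 11) = (\<Sum>p\<in>?T 11. 2 * (1 / (real p)\<^sup>2))"
    by (intro sum.cong refl) (auto simp: root_bound_def)
  also have "\<dots> = 2 * (\<Sum>p\<in>?T 11. 1 / (real p)\<^sup>2)"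
    by (rule sum_distrib_left [symmetric])
  also have "\<dots> \<le> 2 * (1 / (144 * real 16))"
    by (intro mult_left_mono sum_inverse_squares_progression_le) auto
  finally show ?thesis
    by (simp add: field_simps)
qed

lemma not_dvd_4_27:
  fixes p :: nat
  assumes "prime p" "p > 3"
  shows "\<not> p dvd 4 \<and> \<not> p dvd 27"
proof -
  have "\<not> p dvd 2" "\<not> p dvd 3"
    using assms by (auto dest: dvd_imp_le)
  then have "\<not> p dvd 2 ^ 2" "\<not> p dvd 3 ^ 3"
    using assms prime_dvd_power by blast+
  then show ?thesis
    by simp
qed

section \<open>Combining the sieve with the abc conjecture\<close>

lemma squarefree_density:
  fixes \<alpha> \<beta> k :: nat and s :: real
  assumes abc: abc_conjecture
    and pos: "\<alpha> > 0" "\<beta> > 0" and k: "k dvd 12"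
    and ndvd: "\<And>p. prime p \<Longrightarrow> p > 3 \<Longrightarrow> \<not> p dvd \<alpha> \<and> \<not> p dvd \<beta>"
    and mod12: "\<And>p x. prime p \<Longrightarrow> p > 3 \<Longrightarrow> [\<alpha> * x ^ k = \<beta>] (mod p) \<Longrightarrow> p mod 12 = 1 \<or> p mod 12 = 11"
    and s: "(\<Sum>p\<in>small_primes. real (root_bound \<alpha> \<beta> k p) / (real p)\<^sup>2) + (real k + 2) / 2304 \<le> s"
  obtains \<kappa> where "\<kappa> \<ge> 1 - s"
    "(\<lambda>X. real (card {n\<in>{1..X}. \<forall>p. prime p \<and> p > 3 \<longrightarrow>
        \<not> (int p)\<^sup>2 dvd int \<alpha> * int n ^ k - int \<beta>}) / real X) \<longlonglongrightarrow> \<kappa>"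
proof -
  define P where "P = {p :: nat. prime p \<and> p > 3}"
  define E where "E = square_divisor_set \<alpha> \<beta> k"
  have k0: "k > 0"
    using k by (auto intro!: Nat.gr0I)
  have large: "eventually (\<lambda>X. real (card {n\<in>{1..X}. \<exists>p\<in>P. p ^ 3 > X\<^sup>2 \<and> n \<in> E p}) \<le> \<delta> * real X) sequentially"
    if "\<delta> > 0" for \<delta> :: real
  proof -
    have "eventually (\<lambda>X. real (card {n\<in>{1..X}. large_square_divisor \<alpha> \<beta> k n}) \<le> \<delta> * real X) sequentially"
    proof (rule multiplicatively_sparse_density_zero [OF _ that])
      fix a b :: nat assume ab: "odd a" "odd b" "a \<noteq> b"
      show "eventually (\<lambda>n. \<not> (large_square_divisor \<alpha> \<beta> k (a * n) \<and> large_square_divisor \<alpha> \<beta> k (b * n))) sequentially"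
      proof (cases "b < a")
        case True
        then show ?thesis
          using abc_imp_not_both_large_square_divisor [OF abc pos k0 ab(1,2)] by simp
      next
        case False
        then show ?thesis
          using abc_imp_not_both_large_square_divisor [OF abc pos k0 ab(2,1)] ab(3) by (simp add: conj_commute)
      qed
    qed
    then show ?thesis
    proof (rule eventually_mono)
      fix X assume le: "real (card {n\<in>{1..X}. large_square_divisor \<alpha> \<beta> k n}) \<le> \<delta> * real X"
      have "card {n\<in>{1..X}. \<exists>p\<in>P. p ^ 3 > X\<^sup>2 \<and> n \<in> E p} \<le> card {n\<in>{1..X}. large_square_divisor \<alpha> \<beta> k n}"
      proof (intro card_mono subsetI)
        fix n assume "n \<in> {n\<in>{1..X}. \<exists>p\<in>P. p ^ 3 > X\<^sup>2 \<and> n \<in> E p}"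
        then obtain p where n: "n \<in> {1..X}" and p: "p \<in> P" "p ^ 3 > X\<^sup>2" "n \<in> E p"
          by blast
        \<comment> \<open>A prime beyond the cutoff for \<open>X\<close> is also beyond the cutoff
          for \<open>n\<close>, which is the one in \<open>large_square_divisor\<close>.\<close>
        have "n\<^sup>2 \<le> X\<^sup>2"
          using n by (intro power_mono) auto
        with p have "p ^ 3 > n\<^sup>2"
          by linarith
        with n p show "n \<in> {n\<in>{1..X}. large_square_divisor \<alpha> \<beta> k n}"
          by (auto simp: large_square_divisor_def P_def E_def square_divisor_set_def)
      qed simp
      with le show "real (card {n\<in>{1..X}. \<exists>p\<in>P. p ^ 3 > X\<^sup>2 \<and> n \<in> E p}) \<le> \<delta> * real X"
        by linarith
    qed
  qed
  have "\<exists>\<kappa>\<ge>1 - s. (\<lambda>X. real (card {n\<in>{1..X}. \<forall>p\<in>P. n \<notin> E p}) / real X) \<longlonglongrightarrow> \<kappa>"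
  proof (rule sieve_density [where P = P and E = E and r = "root_bound \<alpha> \<beta> k" and K = "k + 2" and s = s])
    show "0 \<notin> P"
      by (simp add: P_def)
    show "periodic_mod (p\<^sup>2) (E p)" for p
    proof (rule periodic_modI)
      fix n
      have "[\<alpha> * (n mod p\<^sup>2) ^ k = \<alpha> * n ^ k] (mod p\<^sup>2)"
        by (intro cong_scalar_left cong_pow) simp
      then show "n \<in> E p \<longleftrightarrow> n mod p\<^sup>2 \<in> E p"
        unfolding E_def in_square_divisor_set_iff_cong by (meson cong_sym cong_trans)
    qed
    show "card (E p \<inter> {..<p\<^sup>2}) \<le> root_bound \<alpha> \<beta> k p" if "p \<in> P" for p
    proof -
      have p: "prime p" "p > 3"
        using that by (auto simp: P_def)
      have "\<not> p dvd k"
      proof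
        assume "p dvd k"
        then have "p dvd 4 * 3"
          using k dvd_trans [of p k 12] by simp
        then have "p dvd 4 \<or> p dvd 3"
          using prime_dvd_mult_iff [OF p(1)] by blast
        then show False
          using not_dvd_4_27 [OF p] p dvd_imp_le [of p 3] by auto
      qed
      then show ?thesis
        unfolding E_def using p ndvd mod12 k by (intro card_square_divisor_set_le_root_bound) auto
    qed
    show "root_bound \<alpha> \<beta> k p \<le> k + 2" for p
      by (simp add: root_bound_def)
    show "(\<Sum>p\<in>{p\<in>P. p \<le> z}. real (root_bound \<alpha> \<beta> k p) / (real p)\<^sup>2) \<le> s" for z
      unfolding P_def using sum_root_bound_le [where z = z and \<alpha> = \<alpha> and \<beta> = \<beta>, OF k0] s by linarith
  qed (use large in auto)
  then obtain \<kappa> where \<kappa>: "\<kappa> \<ge> 1 - s" "(\<lambda>X. real (card {n\<in>{1..X}. \<forall>p\<in>P. n \<notin> E p}) / real X) \<longlonglongrightarrow> \<kappa>"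
    by blast
  have "(\<forall>p\<in>P. n \<notin> E p) \<longleftrightarrow> (\<forall>p. prime p \<and> p > 3 \<longrightarrow> \<not> (int p)\<^sup>2 dvd int \<alpha> * int n ^ k - int \<beta>)" for n
    by (auto simp: P_def E_def square_divisor_set_def)
  with \<kappa> show ?thesis
    by (intro that) auto
qed

section \<open>Passage to real \<open>x\<close>, and the numerical evaluation for the two
  families\<close>

text \<open>The count depends on \<open>x\<close> only through its floor, and the ratio of the floor
  to \<open>x\<close> tends to \<open>1\<close>, so a limit along integers suffices.\<close>

lemma asymp_equiv_count_if_density:
  fixes Q :: "nat \<Rightarrow> bool" and Q' :: "int \<Rightarrow> bool"
  assumes lim: "(\<lambda>X. real (card {n\<in>{1..X}. Q n}) / real X) \<longlonglongrightarrow> \<kappa>" and "\<kappa> > 0"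
    and Q: "\<And>n. n > 0 \<Longrightarrow> Q' (int n) \<longleftrightarrow> Q n"
  shows "(\<lambda>x. real (card {n :: int. 0 < real_of_int n \<and> real_of_int n \<le> x \<and> Q' n})) \<sim>[at_top] (\<lambda>x. \<kappa> * x)"
proof -
  define c where "c X = real (card {n\<in>{1..X}. Q n})" for X
  have eq: "real (card {n :: int. 0 < real_of_int n \<and> real_of_int n \<le> x \<and> Q' n}) = c (nat \<lfloor>x\<rfloor>)" for x
  proof -
    have "{n :: int. 0 < real_of_int n \<and> real_of_int n \<le> x \<and> Q' n} = int ` {n\<in>{1..nat \<lfloor>x\<rfloor>}. Q n}"
    proof (rule Set.set_eqI)
      fix n :: int
      show "n \<in> {n. 0 < real_of_int n \<and> real_of_int n \<le> x \<and> Q' n} \<longleftrightarrow> n \<in> int ` {n\<in>{1..nat \<lfloor>x\<rfloor>}. Q n}"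
      proof (cases "n > 0")
        case True
        then obtain m where m: "n = int m" "m > 0"
          by (metis pos_int_cases)
        then have "real_of_int n \<le> x \<longleftrightarrow> m \<le> nat \<lfloor>x\<rfloor>"
          by (simp add: le_nat_iff le_floor_iff nat_le_iff) linarith
        with m show ?thesis
          by (auto simp: Q)
      qed auto
    qed
    then show ?thesis
      by (simp add: c_def card_image)
  qed
  have "filterlim (\<lambda>x::real. nat \<lfloor>x\<rfloor>) sequentially at_top"
    by real_asymp
  then have "((\<lambda>x::real. c (nat \<lfloor>x\<rfloor>) / real (nat \<lfloor>x\<rfloor>)) \<longlongrightarrow> \<kappa>) at_top"
    using lim unfolding c_def by (rule filterlim_compose [rotated])
  moreover have "((\<lambda>x::real. real (nat \<lfloor>x\<rfloor>) / x) \<longlongrightarrow> 1) at_top"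
    by real_asymp
  ultimately have "((\<lambda>x. c (nat \<lfloor>x\<rfloor>) / real (nat \<lfloor>x\<rfloor>) * (real (nat \<lfloor>x\<rfloor>) / x) / \<kappa>) \<longlongrightarrow> \<kappa> * 1 / \<kappa>) at_top"
    using \<open>\<kappa> > 0\<close> by (intro tendsto_divide tendsto_mult tendsto_const) auto
  moreover have "eventually (\<lambda>x. c (nat \<lfloor>x\<rfloor>) / real (nat \<lfloor>x\<rfloor>) * (real (nat \<lfloor>x\<rfloor>) / x) / \<kappa> = c (nat \<lfloor>x\<rfloor>) / (\<kappa> * x)) at_top"
    using eventually_ge_at_top [of "1 :: real"]
  proof eventually_elim
    case (elim x)
    define X where "X = nat \<lfloor>x\<rfloor>"
    have "X > 0"
      using elim by (simp add: X_def)
    with elim show ?case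
      unfolding X_def [symmetric] by (simp add: field_simps)
  qed
  ultimately have "((\<lambda>x. c (nat \<lfloor>x\<rfloor>) / (\<kappa> * x)) \<longlongrightarrow> \<kappa> * 1 / \<kappa>) at_top"
    by (rule Lim_transform_eventually)
  then show ?thesis
    unfolding eq using \<open>\<kappa> > 0\<close> by (intro asymp_equivI') simp
qed

text \<open>A prime above \<open>3\<close> does not see the factor \<open>16\<close>. Both signs
  occur: the families are \<open>-16 (27 n^4 - 4)\<close> and
  \<open>16 (4 m^6 - 27)\<close>.\<close>

lemma squarefree_away_from_2_iff:
  fixes d y :: int
  assumes "d = 16 * y \<or> d = - 16 * y"
  shows "(\<forall>p :: int. prime p \<and> p > 3 \<longrightarrow> primary_part_squarefree p d) \<longleftrightarrow>
    (\<forall>p :: nat. prime p \<and> p > 3 \<longrightarrow> \<not> (int p)\<^sup>2 dvd y)"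
proof -
  have iff: "primary_part_squarefree p d \<longleftrightarrow> \<not> p\<^sup>2 dvd y" if p: "prime p" "p > 3" for p :: int
  proof -
    have "\<not> p dvd 2"
      using p zdvd_imp_le [of p 2] by auto
    then have "coprime p 2"
      by (rule prime_imp_coprime [OF p(1)])
    then have "coprime (p\<^sup>2) (2 ^ 4)"
      by (simp only: coprime_power_left_iff coprime_power_right_iff simp_thms)
    moreover have "(2 :: int) ^ 4 = 16"
      by simp
    ultimately have "coprime (p\<^sup>2) 16"
      by (simp only:)
    then have "p\<^sup>2 dvd 16 * y \<longleftrightarrow> p\<^sup>2 dvd y"
      by (rule coprime_dvd_mult_right_iff)
    then show ?thesis
      using assms by (auto simp: primary_part_squarefree_def)
  qed
  show ?thesis
  proof safe
    fix p :: nat assume "\<forall>p :: int. prime p \<and> p > 3 \<longrightarrow> primary_part_squarefree p d" "prime p" "p > 3"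
      and dvd: "(int p)\<^sup>2 dvd y"
    then have "primary_part_squarefree (int p) d"
      by simp
    with dvd show False
      using iff [of "int p"] \<open>prime p\<close> \<open>p > 3\<close> by simp
  next
    fix p :: int assume all: "\<forall>p :: nat. prime p \<and> p > 3 \<longrightarrow> \<not> (int p)\<^sup>2 dvd y"
      and p: "prime p" "p > 3"
    have "nat p > 3"
      using p(2) by simp
    moreover have "prime (nat p)"
      using prime_int_nat_transfer [of p] p(1) by blast
    ultimately have "\<not> (int (nat p))\<^sup>2 dvd y"
      using all by blast
    then show "primary_part_squarefree p d"
      using iff [OF p] p by simp
  qed
qed

text \<open>The entry \<open>4\<close> marks the primes that are \<open>1\<close> modulo
  \<open>12\<close> and modulo which \<open>4 / 27\<close> is a fourth power.\<close>

lemma root_bound_N: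
  "root_bound 27 4 4 11 = 2"
  "root_bound 27 4 4 13 = 0"
  "root_bound 27 4 4 23 = 2"
  "root_bound 27 4 4 37 = 4"
  "root_bound 27 4 4 47 = 2"
  "root_bound 27 4 4 59 = 2"
  "root_bound 27 4 4 61 = 4"
  "root_bound 27 4 4 71 = 2"
  "root_bound 27 4 4 73 = 0"
  "root_bound 27 4 4 83 = 2"
  "root_bound 27 4 4 97 = 0"
  "root_bound 27 4 4 107 = 2"
  "root_bound 27 4 4 109 = 0"
  "root_bound 27 4 4 131 = 2"
  "root_bound 27 4 4 157 = 4"
  "root_bound 27 4 4 167 = 2"
  "root_bound 27 4 4 179 = 2"
  "root_bound 27 4 4 181 = 0"
  "root_bound 27 4 4 191 = 2"
  "root_bound 27 4 4 193 = 4"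
  by (simp_all add: root_bound_def)

lemma count_N_asymp_equiv:
  assumes abc_conjecture
  shows "\<exists>\<kappa>>0.97. (\<lambda>x. real (count_N x)) \<sim>[at_top] (\<lambda>x. \<kappa> * x)"
proof -
  \<comment> \<open>The loss is about \<open>0.0298\<close>; the bound \<open>0.0299\<close> lies
    just above it and still below the \<open>0.03\<close> that the claim allows.\<close>
  obtain \<kappa> :: real where \<kappa>: "\<kappa> \<ge> 1 - 0.0299"
    "(\<lambda>X. real (card {n\<in>{1..X}. \<forall>p. prime p \<and> p > 3 \<longrightarrow>
        \<not> (int p)\<^sup>2 dvd int 27 * int n ^ 4 - int 4}) / real X) \<longlonglongrightarrow> \<kappa>"
  proof (rule squarefree_density [OF assms, of 27 4 4 "0.0299"])
    fix p x :: nat assume p: "prime p" "p > 3" and cong: "[27 * x ^ 4 = 4] (mod p)"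
    \<comment> \<open>Tripling produces squares: \<open>81 x^4 = (9 x^2)^2\<close> and
      \<open>12 = 3 * 2^2\<close>, so \<open>3\<close> is a square modulo \<open>p\<close>.\<close>
    have "[3 * (27 * x ^ 4) = 3 * 4] (mod p)"
      using cong by (rule cong_scalar_left)
    then have "[int (3 * (27 * x ^ 4)) = int (3 * 4)] (mod int p)"
      by (simp only: cong_int_iff)
    then have "[(9 * (int x)\<^sup>2)\<^sup>2 = 3 * 2\<^sup>2] (mod int p)"
      by (simp add: power_mult_distrib)
    moreover have "\<not> int p dvd 2"
      using p by (auto dest: zdvd_imp_le)
    ultimately show "p mod 12 = 1 \<or> p mod 12 = 11"
      using mod_12_if_3_square p by blast
  next
    show "(\<Sum>p\<in>small_primes. real (root_bound 27 4 4 p) / (real p)\<^sup>2) + (real 4 + 2) / 2304 \<le> 0.0299"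
      unfolding sum_small_primes root_bound_N by simp
  qed (use not_dvd_4_27 in auto)
  have "(\<lambda>x. real (count_N x)) \<sim>[at_top] (\<lambda>x. \<kappa> * x)"
    unfolding count_N_def
  proof (rule asymp_equiv_count_if_density [OF \<kappa>(2)])
    show "\<kappa> > 0"
      using \<kappa>(1) by simp
    show "(\<forall>p. prime p \<and> 3 < p \<longrightarrow> primary_part_squarefree p (Delta 1 (int n))) \<longleftrightarrow>
        (\<forall>p. prime p \<and> 3 < p \<longrightarrow> \<not> (int p)\<^sup>2 dvd int 27 * int n ^ 4 - int 4)" for n
      by (rule squarefree_away_from_2_iff) (simp add: Delta_def)
  qed
  with \<kappa>(1) show ?thesis
    by (intro exI [of _ \<kappa>]) simp
qed

text \<open>The entry \<open>6\<close> marks the primes that are \<open>1\<close> modulo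
  \<open>12\<close> and modulo which \<open>27 / 4\<close> is a sixth power.\<close>

lemma root_bound_M:
  "root_bound 4 27 6 11 = 2"
  "root_bound 4 27 6 13 = 0"
  "root_bound 4 27 6 23 = 2"
  "root_bound 4 27 6 37 = 0"
  "root_bound 4 27 6 47 = 2"
  "root_bound 4 27 6 59 = 2"
  "root_bound 4 27 6 61 = 0"
  "root_bound 4 27 6 71 = 2"
  "root_bound 4 27 6 73 = 0"
  "root_bound 4 27 6 83 = 2"
  "root_bound 4 27 6 97 = 0"
  "root_bound 4 27 6 107 = 2"
  "root_bound 4 27 6 109 = 6"
  "root_bound 4 27 6 131 = 2"
  "root_bound 4 27 6 157 = 6"
  "root_bound 4 27 6 167 = 2"
  "root_bound 4 27 6 179 = 2"
  "root_bound 4 27 6 181 = 0"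
  "root_bound 4 27 6 191 = 2"
  "root_bound 4 27 6 193 = 0"
  by (simp_all add: root_bound_def)

lemma count_M_asymp_equiv:
  assumes abc_conjecture
  shows "\<exists>\<kappa>>0.97. (\<lambda>x. real (count_M x)) \<sim>[at_top] (\<lambda>x. \<kappa> * x)"
proof -
  obtain \<kappa> :: real where \<kappa>: "\<kappa> \<ge> 1 - 0.0299"
    "(\<lambda>X. real (card {n\<in>{1..X}. \<forall>p. prime p \<and> p > 3 \<longrightarrow>
        \<not> (int p)\<^sup>2 dvd int 4 * int n ^ 6 - int 27}) / real X) \<longlonglongrightarrow> \<kappa>"
  proof (rule squarefree_density [OF assms, of 4 27 6 "0.0299"])
    fix p x :: nat assume p: "prime p" "p > 3" and cong: "[4 * x ^ 6 = 27] (mod p)"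
    then have "[int (4 * x ^ 6) = int 27] (mod int p)"
      by (simp only: cong_int_iff)
    then have "[(2 * (int x) ^ 3)\<^sup>2 = 3 * 3\<^sup>2] (mod int p)"
      by (simp add: power_mult_distrib)
    moreover have "\<not> int p dvd 3"
      using p by (auto dest: zdvd_imp_le)
    ultimately show "p mod 12 = 1 \<or> p mod 12 = 11"
      using mod_12_if_3_square p by blast
  next
    show "(\<Sum>p\<in>small_primes. real (root_bound 4 27 6 p) / (real p)\<^sup>2) + (real 6 + 2) / 2304 \<le> 0.0299"
      unfolding sum_small_primes root_bound_M by simp
  qed (use not_dvd_4_27 in auto)
  have "(\<lambda>x. real (count_M x)) \<sim>[at_top] (\<lambda>x. \<kappa> * x)"
    unfolding count_M_def
  proof (rule asymp_equiv_count_if_density [OF \<kappa>(2)])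
    show "\<kappa> > 0"
      using \<kappa>(1) by simp
    show "(\<forall>p. prime p \<and> 3 < p \<longrightarrow> primary_part_squarefree p (Delta (int n) 1)) \<longleftrightarrow>
        (\<forall>p. prime p \<and> 3 < p \<longrightarrow> \<not> (int p)\<^sup>2 dvd int 4 * int n ^ 6 - int 27)" for n
      by (rule squarefree_away_from_2_iff) (simp add: Delta_def)
  qed
  with \<kappa>(1) show ?thesis
    by (intro exI [of _ \<kappa>]) simp
qed

theorem proposition1p3:
  assumes abc_conjecture
  shows "\<exists>\<kappa>\<^sub>1 \<kappa>\<^sub>2 :: real. \<kappa>\<^sub>1 > 0.97 \<and> \<kappa>\<^sub>2 > 0.97 \<and>
           (\<lambda>x. real (count_N x)) \<sim>[at_top] (\<lambda>x. \<kappa>\<^sub>1 * x) \<and>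
           (\<lambda>x. real (count_M x)) \<sim>[at_top] (\<lambda>x. \<kappa>\<^sub>2 * x)"
  using count_N_asymp_equiv [OF assms] count_M_asymp_equiv [OF assms] by blast

end
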